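(* For all $n\in\mathbb{N}$ (with $n\ge1$) there exists a pair $(\phi_n,\psi_n)\in(\mathcal{PC})$ such that $\phi_n\in(\mathcal{CM})$ and \[ \widehat{\psi_n}(t^{-1})\sim \log^{[n]}(t)\quad\text{as } t\to\infty, \] and \[ \widehat{\psi_n}(t^{-1})\sim t\,\bigl(\log(t^{-1})\bigr)^{n}\quad\text{as } t\to0^+, \] where $\log^{[n]}=\underbrace{\log\circ\log\circ\dots\circ\log}_{n\text{ times}}$.
   Context: Notation: $\mathbb{R}_+=[0,\infty)$; $(f\ast g)(t)=\int_0^t f(t-s)g(s)\,ds$; $\widehat{f}(\lambda)=\int_0^\infty e^{-\lambda t}f(t)\,dt$ for $\lambda>0$ is the Laplace transform; $f(t)\sim g(t)$ as $t\to t_*$ means $\lim_{t\to t_*}f(t)/g(t)=1$. The iterated logarithm $\log^{[n]}(t)$ is considered for $t$ large enough that it is defined. $(k,\ell)\in(\mathcal{PC})$ means that $k\in L_{1,loc}(\mathbb{R}_+)$ is nonnegative and nonincreasing, $\ell\in L_{1,loc}(\mathbb{R}_+)$, and $(k\ast\ell)=1$ on $(0,\infty)$. $(\mathcal{CM})$ is the class of completely monotone functions: infinitely differentiable $f:(0,\infty)\to\mathbb{R}$ with $(-1)^nf^{(n)}(\lambda)\ge0$ for all integers $n\ge0$ and all $\lambda>0$. *)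

theory Defs
  imports "HOL-Analysis.Analysis" "HOL-Library.Landau_Symbols"
begin

definition loc_integrable :: "(real \<Rightarrow> real) \<Rightarrow> bool" where
  "loc_integrable f \<longleftrightarrow> (\<forall>T\<ge>0. set_integrable lebesgue {0..T} f)"

definition convolution :: "(real \<Rightarrow> real) \<Rightarrow> (real \<Rightarrow> real) \<Rightarrow> real \<Rightarrow> real" where
  "convolution f g t = (LINT s:{0..t}|lebesgue. f (t - s) * g s)"

definition laplace :: "(real \<Rightarrow> real) \<Rightarrow> real \<Rightarrow> real" where
  "laplace f x = (LINT t:{0..}|lebesgue. exp (- x * t) * f t)"

(* The functions live on the half-line and may be singular at 0, so sign and monotonicity
   are imposed on the open half-line only; values at arguments \<le> 0 are irrelevant.
   The Bochner integral of a non-integrable function is 0, so the last conjunct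
   also forces the convolution integral to exist for every t > 0. *)
definition PC :: "(real \<Rightarrow> real) \<Rightarrow> (real \<Rightarrow> real) \<Rightarrow> bool" where
  "PC k l \<longleftrightarrow>
     loc_integrable k \<and> (\<forall>t>0. 0 \<le> k t) \<and> antimono_on {0<..} k \<and>
     loc_integrable l \<and>
     (\<forall>t>0. convolution k l t = 1)"

(* Iterated derivatives at a point x > 0 depend only on f near x, so nothing is assumed
   about f on the nonpositive half-line. *)
definition completely_monotone :: "(real \<Rightarrow> real) \<Rightarrow> bool" where
  "completely_monotone f \<longleftrightarrow>
     (\<forall>n. \<forall>x>0. (deriv ^^ n) f differentiable at x \<and> 0 \<le> (-1) ^ n * (deriv ^^ n) f x)"

end

theory Submission
  imports Defs "HOL-Probability.Levy" "HOL-Complex_Analysis.Cauchy_Integral_Formula" "HOL-Real_Asymp.Real_Asymp"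
begin

text \<open>
  Put \<open>w = ln \<lambda>\<close> and \<open>G w = Ln ((exp w - 1) / w)\<close>. Since \<open>(exp w - 1) / w = \<integral>\<^sub>0\<^sup>1 exp (a w) da\<close>, the
  map \<open>G\<close> is holomorphic on the strip \<open>\<bar>Im w\<bar> \<le> \<pi>\<close> (the \<open>\<lambda>\<close>-plane cut along the negative half-axis),
  maps it into itself and preserves its lower half. Hence its iterates \<open>G\<^sup>n\<close>, \<open>n \<ge> 1\<close>, make
  \<open>exp (- G\<^sup>n w)\<close> and \<open>exp (G\<^sup>n w - w)\<close> Stieltjes functions of \<open>\<lambda>\<close>: by Cauchy's formula both are
  double Laplace transforms of the nonnegative jump of their imaginary part across the cut. They are
  the transforms of \<open>\<psi>\<^sub>n\<close> and \<open>\<phi>\<^sub>n\<close>. Their product is \<open>1 / \<lambda>\<close>, so \<open>\<phi>\<^sub>n * \<psi>\<^sub>n = 1\<close> by uniqueness of the Laplace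
  transform. The asymptotics come from iterating \<open>exp (- G x) = x / (exp x - 1)\<close>, which is
  equivalent to \<open>- x\<close> at \<open>-\<infinity>\<close> and to \<open>x exp (- x)\<close> at \<open>\<infinity>\<close>.
\<close>

section \<open>The self-map of the strip\<close>

text \<open>With \<open>w = ln lambda\<close> this is \<open>(lambda - 1) / ln lambda\<close>; the
  value 1 fills the removable singularity. The polymorphic type lets the real and the complex
  function share one name.\<close>

definition exp_quot :: "'a::{real_normed_field,banach} \<Rightarrow> 'a" where
  "exp_quot w = (if w = 0 then 1 else (exp w - 1) / w)"

lemma exp_quot_of_real: "exp_quot (complex_of_real x) = complex_of_real (exp_quot x)"
  by (simp add: exp_quot_def exp_of_real)

lemma exp_quot_cnj: "exp_quot (cnj w) = cnj (exp_quot w)"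
  by (simp add: exp_quot_def exp_cnj)

lemma exp_quot_pos: "exp_quot (x::real) > 0"
  by (cases "x > 0") (auto simp: exp_quot_def divide_simps)

text \<open>An antiderivative in \<open>a\<close> is \<open>exp (a w) / w\<close>. The upper norm
  bound, the sign of the imaginary part and monotonicity are all read off this integrand.\<close>

lemma exp_quot_has_integral:
  "((\<lambda>a. exp (of_real a * w)) has_integral exp_quot w) {0..1}"
proof (cases "w = 0")
  case True
  then show ?thesis
    using has_integral_const_real[of "1::'a" 0 1] by (simp add: exp_quot_def)
next
  case False
  have "((\<lambda>a. exp (of_real a * w) / w) has_vector_derivative exp (of_real a * w)) (at a within {0..1})" for a
    using has_vector_derivative_mult_left[OF exp_scaleR_has_vector_derivative_right[of w a "{0..1}"], of "inverse w"] False
    by (simp add: scaleR_conv_of_real divide_inverse mult.assoc)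
  from fundamental_theorem_of_calculus[of 0 1, OF _ this] False
  show ?thesis
    by (simp add: exp_quot_def diff_divide_distrib)
qed

lemma norm_exp_quot_le: "cmod (exp_quot w) \<le> exp_quot (Re w)"
proof -
  have "cmod (integral {0..1} (\<lambda>a. exp (of_real a * w))) \<le> integral {0..1} (\<lambda>a. exp (of_real a * Re w))"
    by (rule integral_norm_bound_integral)
       (use exp_quot_has_integral[of w] exp_quot_has_integral[of "Re w"]
        in \<open>auto simp: norm_exp_eq_Re dest: has_integral_integrable\<close>)
  then show ?thesis
    using integral_unique[OF exp_quot_has_integral[of w]] integral_unique[OF exp_quot_has_integral[of "Re w"]]
    by simp
qed

lemma exp_quot_holomorphic: "exp_quot holomorphic_on A"
proof -
  have "exp_quot holomorphic_on (UNIV :: complex set)"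
  proof (rule no_isolated_singularity')
    have "(\<lambda>w::complex. (exp w - 1) / w) holomorphic_on UNIV - {0}"
      by (intro holomorphic_intros) auto
    then show "exp_quot holomorphic_on (UNIV :: complex set) - {0}"
      by (rule holomorphic_transform) (simp add: exp_quot_def)
    have "((\<lambda>w::complex. (exp w - 1) / w) \<longlongrightarrow> 1) (at 0)"
      using DERIV_exp[of "0::complex"] by (simp add: has_field_derivative_iff)
    then have "((exp_quot :: complex \<Rightarrow> complex) \<longlongrightarrow> 1) (at 0)"
      by (rule Lim_transform_eventually) (simp add: exp_quot_def eventually_at_filter)
    then show "(exp_quot \<longlongrightarrow> exp_quot z) (at z within UNIV)" if "z \<in> {0}" for z :: complex
      using that by (simp add: exp_quot_def)
  qed auto
  then show ?thesis
    by (rule holomorphic_on_subset) simp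
qed

text \<open>The integrand \<open>exp (a Re w) sin (a Im w)\<close> is nonnegative because
  \<open>a Im w\<close> stays in [0, pi], also on the edge \<open>Im w = pi\<close>. By continuity a
  zero integral would make it vanish identically.\<close>

lemma Im_exp_quot_pos:
  assumes "0 < Im w" "Im w \<le> pi"
  shows "Im (exp_quot w) > 0"
proof -
  have I: "((\<lambda>a. Im (exp (of_real a * w))) has_integral Im (exp_quot w)) {0..1}"
    by (rule has_integral_linear[OF exp_quot_has_integral bounded_linear_Im, unfolded o_def])
  have nn: "Im (exp (of_real a * w)) \<ge> 0" if "a \<in> {0..1}" for a
  proof -
    have "a * Im w \<le> 1 * Im w"
      using that assms by (intro mult_right_mono) auto
    with assms(2) have "a * Im w \<le> pi"
      by linarith
    then have "sin (a * Im w) \<ge> 0"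
      using that assms by (intro sin_ge_zero) auto
    then show ?thesis
      by (simp add: Im_exp)
  qed
  have ge: "Im (exp_quot w) \<ge> 0"
    by (rule has_integral_nonneg[OF I nn])
  moreover have "Im (exp_quot w) \<noteq> 0"
  proof
    assume "Im (exp_quot w) = 0"
    with I have 0: "((\<lambda>a. Im (exp (of_real a * w))) has_integral 0) (cbox 0 1)"
      by simp
    \<comment> \<open>At \<open>a = 1\<close> the sine vanishes when \<open>Im w = pi\<close>; at
      \<open>a = 1/2\<close> its argument lies in (0, pi/2].\<close>
    have "Im (exp (of_real (1/2) * w)) = 0"
      by (rule has_integral_0_cbox_imp_0[OF _ _ 0]) (auto intro!: continuous_intros nn)
    moreover have "sin (Im w / 2) > 0"
      using assms by (intro sin_gt_zero) auto
    ultimately show False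
      by (simp add: Im_exp)
  qed
  ultimately show ?thesis by simp
qed

text \<open>A lossy Jordan inequality: cos is at least \<open>sqrt 2 / 2\<close> on [0, pi/4], so
  the mean value theorem bounds \<open>sin (x / 2)\<close> from below, and doubling the angle
  finishes.\<close>

lemma half_le_sin:
  assumes "0 \<le> x" "x \<le> pi / 2"
  shows "x / 2 \<le> sin x"
proof -
  have c: "cos y \<ge> sqrt 2 / 2" if "0 \<le> y" "y \<le> pi / 4" for y
    using cos_monotone_0_pi_le[of y "pi/4"] that by (simp add: cos_45)
  have s: "sin (x / 2) \<ge> x / 2 * (sqrt 2 / 2)"
  proof (cases "x = 0")
    case False
    then obtain z where z: "0 < z" "z < x / 2" "sin (x/2) - sin 0 = (x / 2 - 0) * cos z"
      using MVT2[of 0 "x / 2" sin cos] assms by (auto intro!: derivative_eq_intros)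
    have "x / 2 * (sqrt 2 / 2) \<le> x / 2 * cos z"
      using c[of z] z assms by (intro mult_left_mono) auto
    also have "\<dots> = sin (x / 2)"
      using z(3) by simp
    finally show ?thesis .
  qed simp
  have "x / 2 = 2 * (x / 2 * (sqrt 2 / 2)) * (sqrt 2 / 2)"
    by simp
  also have "\<dots> \<le> 2 * sin (x / 2) * cos (x / 2)"
    using s c[of "x/2"] assms by (intro mult_mono mult_left_mono mult_nonneg_nonneg sin_ge_zero) auto
  also have "\<dots> = sin x"
    by (simp flip: sin_double)
  finally show ?thesis .
qed

text \<open>
  The bound comes from
  \<open>\<bar>exp w - 1\<bar>\<^sup>2 = 4 exp u (sinh (u/2)\<^sup>2 + sin (v/2)\<^sup>2)\<close> for \<open>w = u + iv\<close>.
\<close>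

lemma norm_exp_quot_ge:
  assumes "\<bar>Im w\<bar> \<le> pi"
  shows "exp (Re w / 2) / 2 \<le> cmod (exp_quot w)"
proof (cases "w = 0")
  case False
  define u v where "u = Re w" and "v = Im w"
  have "cmod (exp w - 1) ^ 2 = (exp u * cos v - 1)\<^sup>2 + (exp u * sin v)\<^sup>2"
    by (simp add: cmod_power2 Re_exp Im_exp u_def v_def)
  also have "\<dots> = exp u ^ 2 * ((sin v)\<^sup>2 + (cos v)\<^sup>2) - 2 * exp u * cos v + 1"
    by (simp add: power2_eq_square algebra_simps del: sin_cos_squared_add sin_cos_squared_add3)
  also have "\<dots> = (exp u - 1)\<^sup>2 + exp u * (2 * (1 - cos v))"
    by (simp add: power2_eq_square algebra_simps)
  also have "(exp u - 1)\<^sup>2 = exp u * (2 * sinh (u / 2))\<^sup>2"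
  proof -
    have "exp u = exp (u/2) ^ 2"
      by (simp flip: exp_double)
    then show ?thesis
      by (simp add: sinh_def power2_eq_square exp_minus field_simps)
  qed
  also have "2 * (1 - cos v) = (2 * sin (v / 2))\<^sup>2"
    using cos_double_sin[of "v/2"] by (simp add: power2_eq_square)
  finally have eq: "cmod (exp w - 1) ^ 2 = exp u * ((2 * sinh (u / 2))\<^sup>2 + (2 * sin (v / 2))\<^sup>2)"
    by (simp add: algebra_simps)
  have "\<bar>u / 2\<bar> \<le> \<bar>sinh (u/2)\<bar>"
    using real_le_abs_sinh[of "u / 2"] by (simp add: sinh_field_def exp_minus)
  \<comment> \<open>Here \<open>|Im w| <= pi\<close> enters: it brings \<open>|v| / 2\<close> into
    the range [0, pi/2] of \<open>half_le_sin\<close>.\<close>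
  moreover have "\<bar>v / 2\<bar> \<le> \<bar>2 * sin (v / 2)\<bar>"
    using half_le_sin[of "\<bar>v\<bar> / 2"] assms by (auto simp: v_def abs_if split: if_splits)
  ultimately have "(u / 2)\<^sup>2 \<le> (2 * sinh (u/2))\<^sup>2" "(v / 2)\<^sup>2 \<le> (2 * sin (v / 2))\<^sup>2"
    unfolding abs_le_square_iff[symmetric] by auto
  then have "exp u * ((u / 2)\<^sup>2 + (v / 2)\<^sup>2) \<le> cmod (exp w - 1) ^ 2"
    unfolding eq by (intro mult_left_mono add_mono) auto
  moreover have "exp u * ((u / 2)\<^sup>2 + (v / 2)\<^sup>2) = (exp (u / 2) / 2 * cmod w)\<^sup>2"
  proof -
    have "exp u = exp (u/2) ^ 2"
      by (simp flip: exp_double)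
    then show ?thesis
      by (simp add: power_mult_distrib cmod_power2 u_def v_def power_divide field_simps)
  qed
  ultimately have "exp (u / 2) / 2 * cmod w \<le> cmod (exp w - 1)"
    by (metis norm_ge_zero power2_le_imp_le)
  with False show ?thesis
    by (simp add: exp_quot_def norm_divide divide_simps u_def mult_ac)
qed (simp add: exp_quot_def)

section \<open>The logarithm of the quotient and its mapping properties on the strip\<close>

text \<open>Both edges, the two sides of the cut, belong to the set, so
  \<open>holomorphic_on strip\<close> includes differentiability within the strip at edge
  points.\<close>

abbreviation strip :: "complex set" where
  "strip \<equiv> {w. \<bar>Im w\<bar> \<le> pi}"

definition log_quot :: "'a::{real_normed_field,banach,ln} \<Rightarrow> 'a" where
  "log_quot w = ln (exp_quot w)"

text \<open>Off the real axis the imaginary part is nonzero, conjugation covering the lower half; on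
  the axis the value is positive. Hence the principal logarithm is holomorphic along
  \<open>exp_quot\<close>.\<close>

lemma exp_quot_nonpos:
  assumes "w \<in> strip"
  shows "exp_quot w \<notin> \<real>\<^sub>\<le>\<^sub>0"
proof -
  consider "Im w = 0" | "Im w > 0" | "Im (cnj w) > 0" by fastforce
  then show ?thesis
  proof cases
    case 1
    then have "w = of_real (Re w)"
      by (simp add: complex_eq_iff)
    then have "exp_quot w = of_real (exp_quot (Re w))"
      by (metis exp_quot_of_real)
    with exp_quot_pos[of "Re w"] show ?thesis
      by (auto simp: complex_nonpos_Reals_iff)
  next
    case 2
    with Im_exp_quot_pos[of w] assms show ?thesis
      by (auto simp: complex_nonpos_Reals_iff)
  next
    case 3
    with Im_exp_quot_pos[of "cnj w"] assms show ?thesis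
      by (auto simp: complex_nonpos_Reals_iff exp_quot_cnj)
  qed
qed

lemma exp_quot_nonzero: "w \<in> strip \<Longrightarrow> exp_quot w \<noteq> 0"
  using exp_quot_nonpos[of w] by auto

lemma exp_log_quot_real: "exp (log_quot (x::real)) = exp_quot x"
  by (simp add: log_quot_def exp_quot_pos)

lemma log_quot_of_real: "log_quot (complex_of_real x) = complex_of_real (log_quot x)"
  by (simp add: log_quot_def exp_quot_of_real Ln_of_real exp_quot_pos)

lemma log_quot_strip: "w \<in> strip \<Longrightarrow> log_quot w \<in> strip"
  using mpi_less_Im_Ln[of "exp_quot w"] Im_Ln_le_pi[of "exp_quot w"] exp_quot_nonzero[of w]
  by (auto simp: log_quot_def)

lemma log_quot_cnj: "w \<in> strip \<Longrightarrow> log_quot (cnj w) = cnj (log_quot w)"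
  using exp_quot_nonpos[of w] by (simp add: log_quot_def exp_quot_cnj cnj_Ln)

lemma log_quot_holomorphic: "log_quot holomorphic_on strip"
  unfolding log_quot_def
  by (intro holomorphic_intros exp_quot_holomorphic) (use exp_quot_nonpos in auto)

text \<open>The conjugate point lies in the upper half, where \<open>exp_quot\<close> has positive
  imaginary part and so positive argument; conjugation symmetry carries this back.\<close>

lemma Im_log_quot_nonpos:
  assumes "w \<in> strip" "Im w \<le> 0"
  shows "Im (log_quot w) \<le> 0"
proof -
  have "Im (log_quot (cnj w)) \<ge> 0"
  proof (cases "Im w = 0")
    case True
    then have "cnj w = of_real (Re w)"
      by (simp add: complex_eq_iff)
    then show ?thesis
      by (simp add: log_quot_of_real)
  next
    case False
    then have "Im (exp_quot (cnj w)) > 0"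
      using assms by (intro Im_exp_quot_pos) auto
    then have "0 < Im (Ln (exp_quot (cnj w)))"
      by (subst Im_Ln_pos_lt_imp) auto
    then show ?thesis by (simp add: log_quot_def)
  qed
  with assms show ?thesis
    by (simp add: log_quot_cnj)
qed

lemma Re_log_quot_le: "w \<in> strip \<Longrightarrow> Re (log_quot w) \<le> log_quot (Re w)"
  unfolding log_quot_def using norm_exp_quot_le[of w] exp_quot_nonzero[of w]
  by (simp add: exp_quot_pos)

lemma Re_log_quot_ge:
  assumes "w \<in> strip"
  shows "Re w / 2 - ln 2 \<le> Re (log_quot w)"
proof -
  have "ln (exp (Re w / 2) / 2) \<le> ln (cmod (exp_quot w))"
    using norm_exp_quot_ge[of w] assms exp_quot_nonzero[of w] by simp
  with assms show ?thesis
    by (simp add: ln_div log_quot_def exp_quot_nonzero)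
qed

text \<open>Each integrand \<open>exp (a x)\<close> with \<open>a >= 0\<close> increases in
  \<open>x\<close>. This lets the upper bound on real parts pass through the iteration.\<close>

lemma log_quot_mono: "mono (log_quot :: real \<Rightarrow> real)"
proof
  fix x y :: real assume "x \<le> y"
  have "exp_quot x \<le> exp_quot y"
    by (rule has_integral_le[OF exp_quot_has_integral exp_quot_has_integral])
       (use \<open>x \<le> y\<close> in \<open>auto intro!: mult_left_mono\<close>)
  then show "log_quot x \<le> log_quot y"
    by (simp add: log_quot_def exp_quot_pos)
qed

section \<open>Iterates of the self-map\<close>

lemma funpow_log_quot_strip: "w \<in> strip \<Longrightarrow> (log_quot ^^ n) w \<in> strip"
  by (induction n) (simp_all add: log_quot_strip[simplified])

lemma funpow_log_quot_of_real: "(log_quot ^^ n) (complex_of_real x) = complex_of_real ((log_quot ^^ n) x)"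
  by (induction n) (simp_all add: log_quot_of_real)

lemma funpow_log_quot_cnj: "w \<in> strip \<Longrightarrow> (log_quot ^^ n) (cnj w) = cnj ((log_quot ^^ n) w)"
  by (induction n) (simp_all add: log_quot_cnj funpow_log_quot_strip[simplified])

lemma funpow_log_quot_holomorphic: "(log_quot ^^ n) holomorphic_on strip"
proof (induction n)
  case 0
  then show ?case by (simp add: id_def)
next
  case (Suc n)
  have "(log_quot \<circ> (log_quot ^^ n)) holomorphic_on strip"
    by (rule holomorphic_on_compose_gen[OF Suc log_quot_holomorphic]) (use funpow_log_quot_strip in blast)
  then show ?case by (simp add: o_def)
qed

lemma Im_funpow_log_quot_nonpos:
  "w \<in> strip \<Longrightarrow> Im w \<le> 0 \<Longrightarrow> Im ((log_quot ^^ n) w) \<le> 0"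
proof (induction n)
  case (Suc n)
  then have "Im (log_quot ((log_quot ^^ n) w)) \<le> 0"
    by (intro Im_log_quot_nonpos funpow_log_quot_strip)
  then show ?case by simp
qed simp

lemma Re_funpow_log_quot_le:
  "w \<in> strip \<Longrightarrow> Re ((log_quot ^^ n) w) \<le> (log_quot ^^ n) (Re w)"
proof (induction n)
  case (Suc n)
  then have "Re (log_quot ((log_quot ^^ n) w)) \<le> log_quot (Re ((log_quot ^^ n) w))"
    by (intro Re_log_quot_le funpow_log_quot_strip)
  also have "\<dots> \<le> log_quot ((log_quot ^^ n) (Re w))"
    using Suc by (intro monoD[OF log_quot_mono]) auto
  finally show ?case by simp
qed simp

text \<open>One step turns a lower bound \<open>r\<close> into \<open>r / 2 - ln 2\<close>. This
  affine map has the fixed point \<open>- 2 * ln 2\<close>, so the same constant serves every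
  \<open>n\<close>.\<close>

lemma Re_funpow_log_quot_ge:
  "w \<in> strip \<Longrightarrow> Re w / 2 ^ n - 2 * ln 2 \<le> Re ((log_quot ^^ n) w)"
proof (induction n)
  case (Suc n)
  have "Re w / 2 ^ Suc n - 2 * ln 2 = (Re w / 2 ^ n - 2 * ln 2) / 2 - ln 2"
    by (simp add: field_simps)
  also have "\<dots> \<le> Re ((log_quot ^^ n) w) / 2 - ln 2"
    by (intro diff_right_mono divide_right_mono Suc.IH Suc.prems) simp
  also have "\<dots> \<le> Re (log_quot ((log_quot ^^ n) w))"
    using Suc by (intro Re_log_quot_ge funpow_log_quot_strip)
  finally show ?case by simp
qed simp

section \<open>Asymptotics of the iterates on the real axis\<close>

lemma log_quot_asymp_equiv: "(log_quot :: real \<Rightarrow> real) \<sim>[at_top] (\<lambda>x. x)"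
proof -
  have "(\<lambda>x::real. ln ((exp x - 1) / x)) \<sim>[at_top] (\<lambda>x. x)"
    by real_asymp
  moreover have "\<forall>\<^sub>F x::real in at_top. ln ((exp x - 1) / x) = log_quot x"
    using eventually_gt_at_top[of 0] by eventually_elim (simp add: log_quot_def exp_quot_def)
  ultimately show ?thesis
    by (subst (asm) asymp_equiv_cong[OF _ always_eventually]) auto
qed

lemma funpow_log_quot_asymp_equiv: "((log_quot :: real \<Rightarrow> real) ^^ n) \<sim>[at_top] (\<lambda>x. x)"
proof (induction n)
  case 0
  then show ?case by (simp add: id_def)
next
  case (Suc n)
  have "filterlim ((log_quot :: real \<Rightarrow> real) ^^ n) at_top at_top"
    by (rule asymp_equiv_at_top_transfer[OF asymp_equiv_symI[OF Suc] filterlim_ident])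
  from asymp_equiv_compose'[OF log_quot_asymp_equiv this] Suc show ?case
    by (simp add: asymp_equiv_trans)
qed

text \<open>Asymptotic equivalence need not survive exponentiation, so the induction runs on the
  exponentials: \<open>exp (- log_quot y)\<close> is equivalent to \<open>exp (- y) * y\<close>, and
  for \<open>y = (log_quot ^^ n) x\<close> the new factor \<open>y\<close> is equivalent to
  \<open>x\<close>.\<close>

lemma exp_funpow_log_quot_at_top:
  "(\<lambda>x. exp (- (log_quot ^^ n) x)) \<sim>[at_top] (\<lambda>x::real. exp (- x) * x ^ n)"
proof (induction n)
  case (Suc n)
  have lim: "filterlim ((log_quot :: real \<Rightarrow> real) ^^ n) at_top at_top"
    by (rule asymp_equiv_at_top_transfer[OF asymp_equiv_symI[OF funpow_log_quot_asymp_equiv] filterlim_ident])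
  have "(\<lambda>x::real. x / (exp x - 1)) \<sim>[at_top] (\<lambda>x. exp (- x) * x)"
    by real_asymp
  moreover have "\<forall>\<^sub>F x::real in at_top. x / (exp x - 1) = exp (- log_quot x)"
    using eventually_gt_at_top[of 0]
    by eventually_elim (simp add: exp_minus exp_log_quot_real exp_quot_def field_simps)
  ultimately have "(\<lambda>x::real. exp (- log_quot x)) \<sim>[at_top] (\<lambda>x. exp (- x) * x)"
    by (subst (asm) asymp_equiv_cong[OF _ always_eventually]) auto
  from asymp_equiv_compose'[OF this lim]
  have "(\<lambda>x. exp (- log_quot ((log_quot ^^ n) x))) \<sim>[at_top]
      (\<lambda>x. exp (- (log_quot ^^ n) x) * (log_quot ^^ n) (x::real))" .
  also have "\<dots> \<sim>[at_top] (\<lambda>x. (exp (- x) * x ^ n) * x)"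
    by (intro asymp_equiv_mult Suc funpow_log_quot_asymp_equiv)
  finally show ?case by (simp add: mult_ac)
qed simp

lemma filterlim_funpow_ln: "filterlim ((ln :: real \<Rightarrow> real) ^^ n) at_top at_top"
proof (induction n)
  case (Suc n)
  from filterlim_compose[OF ln_at_top Suc] show ?case by simp
qed (simp add: id_def filterlim_ident)

text \<open>\<open>ln f / ln g = 1 + ln (f / g) / ln g\<close>, where \<open>ln (f / g)\<close>
  tends to 0 and \<open>ln g\<close> to infinity.\<close>

lemma ln_asymp_equiv_cong:
  fixes f g :: "real \<Rightarrow> real"
  assumes "f \<sim>[F] g" "filterlim g at_top F"
  shows "(\<lambda>x. ln (f x)) \<sim>[F] (\<lambda>x. ln (g x))"
proof -
  have f: "filterlim f at_top F"
    using asymp_equiv_at_top_transfer[OF asymp_equiv_symI] assms by blast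
  have ev: "\<forall>\<^sub>F x in F. f x > 0 \<and> g x > 1"
    using f assms(2) by (auto simp: filterlim_at_top_dense eventually_conj_iff)
  have "((\<lambda>x. ln (f x / g x)) \<longlongrightarrow> ln 1) F"
  proof (rule tendsto_ln)
    show "((\<lambda>x. f x / g x) \<longlongrightarrow> 1) F"
      using asymp_equivD[OF assms(1)]
      by (rule Lim_transform_eventually) (use ev in eventually_elim, auto)
  qed (rule one_neq_zero)
  then have "((\<lambda>x. ln (f x / g x)) \<longlongrightarrow> 0) F"
    by simp
  moreover have "((\<lambda>x. inverse (ln (g x))) \<longlongrightarrow> 0) F"
    by (rule tendsto_inverse_0_at_top[OF filterlim_compose[OF ln_at_top assms(2)]])
  ultimately have "((\<lambda>x. 1 + ln (f x / g x) * inverse (ln (g x))) \<longlongrightarrow> 1 + 0 * 0) F"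
    by (intro tendsto_add tendsto_mult tendsto_const)
  then have "((\<lambda>x. 1 + ln (f x / g x) * inverse (ln (g x))) \<longlongrightarrow> 1) F"
    by simp
  then have "((\<lambda>x. ln (f x) / ln (g x)) \<longlongrightarrow> 1) F"
    by (rule Lim_transform_eventually) (use ev in eventually_elim, auto simp: ln_div field_simps)
  then show ?thesis
    by (intro asymp_equivI')
qed

text \<open>The argument \<open>- ln t\<close> is \<open>ln lambda\<close> for
  \<open>lambda = 1 / t\<close>. If \<open>a\<close> is the \<open>n\<close>-th iterate there, then
  \<open>a\<close> tends to minus infinity and \<open>exp (- log_quot a)\<close> is equivalent to
  \<open>- a = ln (exp (- a))\<close>: each iteration adds one logarithm.\<close>

lemma exp_funpow_log_quot_at_bot:
  "(\<lambda>t. exp (- (log_quot ^^ n) (- ln t))) \<sim>[at_top] ((ln :: real \<Rightarrow> real) ^^ n)"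
proof (induction n)
  case 0
  have "\<forall>\<^sub>F t::real in at_top. exp (- (- ln t)) = t"
    using eventually_gt_at_top[of 0] by eventually_elim simp
  then show ?case
    by (simp add: asymp_equiv_refl_ev)
next
  case (Suc n)
  let ?a = "\<lambda>t. (log_quot ^^ n) (- ln t) :: real"
  have top: "filterlim (\<lambda>t. exp (- ?a t)) at_top at_top"
    using asymp_equiv_at_top_transfer[OF asymp_equiv_symI[OF Suc]] filterlim_funpow_ln by blast
  have "filterlim (\<lambda>t. - ?a t) at_top at_top"
    using filterlim_compose[OF ln_at_top top] by simp
  then have bot: "filterlim ?a at_bot at_top"
    by (simp add: filterlim_uminus_at_bot)
  have "(\<lambda>x::real. x / (exp x - 1)) \<sim>[at_bot] (\<lambda>x. - x)"
    by real_asymp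
  moreover have "\<forall>\<^sub>F x::real in at_bot. x / (exp x - 1) = exp (- log_quot x)"
    using eventually_gt_at_bot[of 0]
    by eventually_elim (simp add: exp_minus exp_log_quot_real exp_quot_def field_simps)
  ultimately have "(\<lambda>x::real. exp (- log_quot x)) \<sim>[at_bot] (\<lambda>x. - x)"
    by (subst (asm) asymp_equiv_cong[OF _ always_eventually]) auto
  from asymp_equiv_compose'[OF this bot]
  have "(\<lambda>t. exp (- log_quot (?a t))) \<sim>[at_top] (\<lambda>t. - ?a t)" .
  also have "(\<lambda>t. - ?a t) \<sim>[at_top] (\<lambda>t. ln ((ln ^^ n) t))"
    using ln_asymp_equiv_cong[OF Suc filterlim_funpow_ln] by simp
  finally show ?case by simp
qed

section \<open>Cauchy's formula on the strip\<close>

lemma has_contour_integral_linepath_horizontal: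
  assumes "(f has_contour_integral I) (linepath (Complex a y) (Complex b y))" "a < b"
  shows "((\<lambda>u. f (Complex u y)) has_integral I) {a..b}"
proof -
  have eq: "linepath (Complex a y) (Complex b y) s = linepath (of_real a) (of_real b) s + Complex 0 y" for s
    by (simp add: linepath_def complex_eq_iff algebra_simps)
  have "((\<lambda>w. f (w + Complex 0 y)) has_contour_integral I) (linepath (of_real a) (of_real b))"
    using assms(1) unfolding has_contour_integral_linepath eq by (simp add: complex_diff complex_of_real_def)
  from this[unfolded has_contour_integral_linepath_Reals_iff[of "of_real a" "of_real b", simplified, OF assms(2)]]
  show ?thesis
    by (simp add: Complex_eq)
qed

text \<open>The top side is traversed from right to left, which gives the difference in the
  integrand. What remains is the two vertical sides, each bounded by its supremum times its length
  \<open>d - c\<close>.\<close>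

lemma rectpath_horizontal_sides_bound:
  assumes f: "(f has_contour_integral I) (rectpath (Complex a c) (Complex b d))"
    and cont: "continuous_on (path_image (rectpath (Complex a c) (Complex b d))) f"
    and ab: "a < b" "c < d"
    and left: "\<And>y. c \<le> y \<Longrightarrow> y \<le> d \<Longrightarrow> cmod (f (Complex a y)) \<le> M"
    and right: "\<And>y. c \<le> y \<Longrightarrow> y \<le> d \<Longrightarrow> cmod (f (Complex b y)) \<le> N"
  shows "cmod (integral {a..b} (\<lambda>u. f (Complex u c) - f (Complex u d)) - I) \<le> (M + N) * (d - c)"
proof -
  let ?p1 = "linepath (Complex a c) (Complex b c)" and ?p2 = "linepath (Complex b c) (Complex b d)"
  let ?p3 = "linepath (Complex b d) (Complex a d)" and ?p4 = "linepath (Complex a d) (Complex a c)"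
  let ?q3 = "linepath (Complex a d) (Complex b d)"
  have rp: "rectpath (Complex a c) (Complex b d) = ?p1 +++ ?p2 +++ ?p3 +++ ?p4"
    by (simp add: rectpath_def Let_def)
  have int: "f contour_integrable_on p" if "p \<in> {?p1, ?p2, ?p3, ?p4, ?q3}" for p
    using that by (auto intro!: contour_integrable_continuous_linepath continuous_on_subset[OF cont]
        simp: rp path_image_join closed_segment_commute)
  have "I = contour_integral ?p1 f + contour_integral ?p2 f + contour_integral ?p3 f + contour_integral ?p4 f"
    using contour_integral_unique[OF f] int by (simp add: rp add.assoc)
  moreover have "contour_integral ?p3 f = - contour_integral ?q3 f"
    using contour_integral_reversepath[of ?q3 f] by simp
  moreover have "((\<lambda>u. f (Complex u c) - f (Complex u d)) has_integral
      (contour_integral ?p1 f - contour_integral ?q3 f)) {a..b}"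
    by (intro has_integral_diff has_contour_integral_linepath_horizontal
        has_contour_integral_integral int ab) auto
  then have "integral {a..b} (\<lambda>u. f (Complex u c) - f (Complex u d))
      = contour_integral ?p1 f - contour_integral ?q3 f"
    by (rule integral_unique)
  ultimately have eq: "integral {a..b} (\<lambda>u. f (Complex u c) - f (Complex u d)) - I
      = - contour_integral ?p2 f - contour_integral ?p4 f"
    by simp
  have "M \<ge> 0" "N \<ge> 0"
    using order_trans[OF norm_ge_zero left[of c]] order_trans[OF norm_ge_zero right[of c]] ab by auto
  have "cmod (contour_integral ?p2 f) \<le> N * cmod (Complex b d - Complex b c)"
  proof (rule contour_integral_bound_linepath[OF int \<open>N \<ge> 0\<close>])
    fix w assume "w \<in> closed_segment (Complex b c) (Complex b d)"
    then have "Re w = b" "c \<le> Im w" "Im w \<le> d"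
      using ab by (auto simp: closed_segment_same_Re closed_segment_eq_real_ivl)
    then show "cmod (f w) \<le> N"
      using right[of "Im w"] by (metis complex_surj)
  qed simp
  moreover have "cmod (contour_integral ?p4 f) \<le> M * cmod (Complex a c - Complex a d)"
  proof (rule contour_integral_bound_linepath[OF int \<open>M \<ge> 0\<close>])
    fix w assume "w \<in> closed_segment (Complex a d) (Complex a c)"
    then have "Re w = a" "c \<le> Im w" "Im w \<le> d"
      using ab by (auto simp: closed_segment_same_Re closed_segment_eq_real_ivl)
    then show "cmod (f w) \<le> M"
      using left[of "Im w"] by (metis complex_surj)
  qed simp
  moreover have "cmod (Complex b d - Complex b c) = d - c" "cmod (Complex a c - Complex a d) = d - c"
    using ab by (simp_all add: complex_diff cmod_def)
  moreover have "cmod (- contour_integral ?p2 f - contour_integral ?p4 f) \<le>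
      cmod (contour_integral ?p2 f) + cmod (contour_integral ?p4 f)"
    by (metis norm_minus_cancel norm_triangle_ineq4)
  ultimately show ?thesis
    unfolding eq by (simp add: algebra_simps)
qed

text \<open>On the lower edge \<open>exp w = - exp u\<close>, so the Cauchy kernel
  \<open>exp w / (exp w - exp x)\<close> becomes the positive
  \<open>exp u / (exp u + exp x)\<close>.\<close>

lemma continuous_on_strip_edge:
  assumes "H holomorphic_on strip"
  shows "continuous_on A (\<lambda>u. Im (H (Complex u (-pi))) / pi * (exp u / (exp u + exp x)))"
proof -
  have "continuous_on A (\<lambda>u. H (Complex u (-pi)))"
    by (rule continuous_on_compose2[OF holomorphic_on_imp_continuous_on[OF assms]])
       (auto simp: Complex_eq intro!: continuous_intros)
  moreover have "exp u + exp x \<noteq> 0" for u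
    using add_pos_pos[OF exp_gt_zero[of u] exp_gt_zero[of x]] by linarith
  ultimately show ?thesis
    by (intro continuous_intros) auto
qed

text \<open>
  Cauchy's formula with the \<open>2\<pi>i\<close>-periodic kernel \<open>1 / (1 - exp (x - w))\<close>: in the variable
  \<open>exp w\<close> the two horizontal sides of the rectangle are the two edges of the cut along the
  negative half-axis.
\<close>

lemma strip_rectangle_bound:
  fixes H :: "complex \<Rightarrow> complex" and x R :: real
  assumes holo: "H holomorphic_on strip"
    and sym: "\<And>w. w \<in> strip \<Longrightarrow> H (cnj w) = cnj (H w)"
    and bound: "\<And>w. w \<in> strip \<Longrightarrow> cmod (H w) \<le> B (Re w)"
    and R: "\<bar>x\<bar> < R"
  shows "\<bar>integral {-R..R} (\<lambda>u. Im (H (Complex u (-pi))) / pi * (exp u / (exp u + exp x))) - Re (H x)\<bar>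
    \<le> B (-R) * (exp (-R) / \<bar>exp (-R) - exp x\<bar>) + B R * (exp R / \<bar>exp R - exp x\<bar>)"
proof -
  define g where "g w = H w * (exp w / (exp w - exp (of_real x)))" for w
  define \<gamma> where "\<gamma> = rectpath (Complex (-R) (-pi)) (Complex R pi)"
  have img: "path_image \<gamma> \<subseteq> strip - {of_real x}"
    using R path_image_rectpath_subset_cbox[of "Complex (-R) (-pi)" "Complex R pi"]
    unfolding \<gamma>_def
    by (auto simp: path_image_rectpath)
  have strip_conv: "strip = {w. Im w \<le> pi} \<inter> {w. Im w \<ge> - pi}"
    by auto
  have "convex strip"
    unfolding strip_conv by (intro convex_Int convex_halfspace_Im_le convex_halfspace_Im_ge)
  have x_int: "of_real x \<in> interior strip"
  proof (rule interiorI)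
    have eq: "{w. \<bar>Im w\<bar> < pi} = {w. Im w < pi} \<inter> {w. Im w > - pi}"
      by auto
    show "open {w. \<bar>Im w\<bar> < pi}"
      unfolding eq by (intro open_Int open_halfspace_Im_lt open_halfspace_Im_gt)
  qed auto
  \<comment> \<open>As \<open>x\<close> is real, \<open>w - x\<close> stays in the strip, where
    \<open>exp_quot\<close> has no zero; hence \<open>x\<close> is the only pole of the
    kernel.\<close>
  have nz: "exp w - exp (of_real x) \<noteq> 0" if "w \<in> strip" "w \<noteq> of_real x" for w
  proof
    assume 0: "exp w - exp (of_real x) = 0"
    have "exp_quot (w - of_real x) = 0"
      using 0 that by (simp add: exp_quot_def exp_diff)
    with exp_quot_nonzero[of "w - of_real x"] that show False
      by simp
  qed
  \<comment> \<open>Dividing by \<open>exp_quot (w - x)\<close> splits the pole off as the factor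
    \<open>1 / (w - x)\<close> required by Cauchy's formula and leaves a holomorphic
    numerator.\<close>
  have fhol: "(\<lambda>w. H w * (exp w / exp (of_real x)) / exp_quot (w - of_real x)) holomorphic_on strip"
    by (intro holomorphic_intros holo holomorphic_on_compose_gen[OF _ exp_quot_holomorphic[of UNIV], unfolded o_def])
       (use exp_quot_nonzero in auto)
  have cauchy: "((\<lambda>w. H w * (exp w / exp (of_real x)) / exp_quot (w - of_real x) / (w - of_real x))
      has_contour_integral (2 * pi * \<i> * H (of_real x))) \<gamma>"
  proof -
    have "winding_number \<gamma> (of_real x) = 1"
      unfolding \<gamma>_def using R by (intro winding_number_rectpath) (auto simp: in_box_complex_iff)
    moreover have "H (of_real x) * (exp (of_real x) / exp (of_real x)) / exp_quot (of_real x - of_real x)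
        = H (complex_of_real x)"
      by (simp add: exp_quot_def)
    moreover have "valid_path \<gamma>" "pathfinish \<gamma> = pathstart \<gamma>"
      by (simp_all add: \<gamma>_def)
    ultimately show ?thesis
      using Cauchy_integral_formula_convex_simple[OF \<open>convex strip\<close> fhol x_int, of \<gamma>] img
      by (simp only: mult_1_right)
  qed
  from cauchy have contour: "(g has_contour_integral (2 * pi * \<i> * H (of_real x))) \<gamma>"
  proof (rule has_contour_integral_eq)
    fix w assume "w \<in> path_image \<gamma>"
    with img have w: "w \<in> strip" "w \<noteq> of_real x"
      by auto
    have "exp_quot (w - of_real x) = (exp w - exp (of_real x)) / exp (of_real x) / (w - of_real x)"
      using w by (simp add: exp_quot_def exp_diff diff_divide_distrib)
    with nz[OF w] w show "H w * (exp w / exp (of_real x)) / exp_quot (w - of_real x) / (w - of_real x) = g w"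
      by (simp add: g_def)
  qed
  have holog: "g holomorphic_on strip - {of_real x}"
    unfolding g_def
    by (intro holomorphic_intros holomorphic_on_subset[OF holo]) (use nz in auto)
  \<comment> \<open>On a vertical line \<open>exp w\<close> has constant modulus
    \<open>exp a\<close>, so the reverse triangle inequality bounds the denominator from
    below.\<close>
  have side: "cmod (g (Complex a y)) \<le> B a * (exp a / \<bar>exp a - exp x\<bar>)"
    if "a \<noteq> x" "-pi \<le> y" "y \<le> pi" for a y
  proof -
    have "\<bar>exp a - exp x\<bar> = \<bar>cmod (exp (Complex a y)) - cmod (exp (complex_of_real x))\<bar>"
      by simp
    also have "\<dots> \<le> cmod (exp (Complex a y) - exp (complex_of_real x))"
      by (rule norm_triangle_ineq3)
    finally have "exp a / cmod (exp (Complex a y) - exp (of_real x)) \<le> exp a / \<bar>exp a - exp x\<bar>"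
      using that by (intro divide_left_mono mult_pos_pos) auto
    moreover have "cmod (H (Complex a y)) \<le> B a"
      using bound[of "Complex a y"] that by auto
    ultimately show ?thesis
      unfolding g_def norm_mult norm_divide norm_exp_eq_Re complex.sel
      by (intro mult_mono) (auto intro: order_trans[OF norm_ge_zero])
  qed
  have "cmod (integral {-R..R} (\<lambda>u. g (Complex u (-pi)) - g (Complex u pi)) - 2 * pi * \<i> * H (of_real x))
      \<le> (B (-R) * (exp (-R) / \<bar>exp (-R) - exp x\<bar>) + B R * (exp R / \<bar>exp R - exp x\<bar>)) * (pi - (-pi))"
  proof (rule rectpath_horizontal_sides_bound[OF contour[unfolded \<gamma>_def]])
    show "continuous_on (path_image (rectpath (Complex (-R) (-pi)) (Complex R pi))) g"
      using img unfolding \<gamma>_def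
      by (rule continuous_on_subset[OF holomorphic_on_imp_continuous_on[OF holog]])
    show "cmod (g (Complex (-R) y)) \<le> B (-R) * (exp (-R) / \<bar>exp (-R) - exp x\<bar>)"
      if "-pi \<le> y" "y \<le> pi" for y
      using R that by (intro side) auto
    show "cmod (g (Complex R y)) \<le> B R * (exp R / \<bar>exp R - exp x\<bar>)"
      if "-pi \<le> y" "y \<le> pi" for y
      using R that by (intro side) auto
  qed (use R in auto)
  \<comment> \<open>Since \<open>exp w = - exp u\<close> on both edges, the kernel is the same on
    both; by symmetry \<open>H\<close> differs by \<open>2 * \<i>\<close> times its imaginary part
    on the lower edge.\<close>
  moreover have "g (Complex u (-pi)) - g (Complex u pi) =
      2 * pi * \<i> * of_real (Im (H (Complex u (-pi))) / pi * (exp u / (exp u + exp x)))" for u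
  proof -
    have e: "exp (Complex u (-pi)) = - of_real (exp u)" "exp (Complex u pi) = - of_real (exp u)"
      by (simp_all add: exp_eq_polar Complex_eq exp_add exp_of_real cis.ctr complex_eq_iff)
    have "exp u + exp x \<noteq> 0"
      using add_pos_pos[OF exp_gt_zero[of u] exp_gt_zero[of x]] by linarith
    then have k: "exp w / (exp w - exp (of_real x)) = of_real (exp u / (exp u + exp x))"
      if "exp w = - complex_of_real (exp u)" for w
      using that by (simp add: exp_of_real divide_simps flip: of_real_add of_real_minus of_real_diff)
        (simp add: algebra_simps)
    have "H (Complex u (-pi)) - H (Complex u pi) = 2 * \<i> * of_real (Im (H (Complex u (-pi))))"
      using sym[of "Complex u (-pi)"] by (simp add: complex_eq_iff complex_cnj)
    then show ?thesis
      unfolding g_def k[OF e(1)] k[OF e(2)] left_diff_distrib[symmetric] by simp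
  qed
  moreover have "integral {-R..R} (\<lambda>u. 2 * pi * \<i> * of_real (Im (H (Complex u (-pi))) / pi * (exp u / (exp u + exp x))))
      = 2 * pi * \<i> * of_real (integral {-R..R} (\<lambda>u. Im (H (Complex u (-pi))) / pi * (exp u / (exp u + exp x))))"
  proof -
    have "(\<lambda>u. Im (H (Complex u (-pi))) / pi * (exp u / (exp u + exp x))) integrable_on {-R..R}"
      by (intro integrable_continuous_real continuous_on_strip_edge holo)
    then show ?thesis
      by (intro integral_unique has_integral_mult_right has_integral_of_real integrable_integral)
  qed
  moreover have "H (of_real x) = of_real (Re (H (of_real x)))"
    using sym[of "of_real x"] by (simp add: complex_eq_iff)
  ultimately have "cmod (2 * pi * \<i> * of_real (integral {-R..R} (\<lambda>u. Im (H (Complex u (-pi))) / pi * (exp u / (exp u + exp x)))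
      - Re (H (of_real x)))) \<le>
    (B (-R) * (exp (-R) / \<bar>exp (-R) - exp x\<bar>) + B R * (exp R / \<bar>exp R - exp x\<bar>)) * (pi - (-pi))"
    by (simp only: of_real_diff right_diff_distrib)
  \<comment> \<open>The vertical sides have length \<open>2 * pi\<close>, which cancels against the
    modulus of \<open>2 * pi * \<i>\<close>.\<close>
  moreover have "cmod (2 * pi * \<i> * of_real r) = \<bar>r\<bar> * (pi - (-pi))" for r
    by (simp add: norm_mult)
  ultimately show ?thesis
    using pi_gt_zero by (simp only: mult_le_cancel_right)
qed

text \<open>Let the rectangle grow. The integrand is nonnegative, so monotone convergence yields
  integrability together with the value.\<close>

theorem strip_poisson_formula:
  fixes H :: "complex \<Rightarrow> complex" and x :: real
  assumes holo: "H holomorphic_on strip"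
    and sym: "\<And>w. w \<in> strip \<Longrightarrow> H (cnj w) = cnj (H w)"
    and pos: "\<And>u. Im (H (Complex u (-pi))) \<ge> 0"
    and bound: "\<And>w. w \<in> strip \<Longrightarrow> cmod (H w) \<le> B (Re w)"
    and top: "(B \<longlongrightarrow> 0) at_top"
    and bot: "((\<lambda>u. exp u * B u) \<longlongrightarrow> 0) at_bot"
  shows "has_bochner_integral lborel
    (\<lambda>u. Im (H (Complex u (-pi))) / pi * (exp u / (exp u + exp x))) (Re (H x))"
proof -
  define q where "q u = Im (H (Complex u (-pi))) / pi * (exp u / (exp u + exp x))" for u
  have cont: "continuous_on A q" for A
    unfolding q_def by (rule continuous_on_strip_edge[OF holo])
  have q0: "q u \<ge> 0" for u
    unfolding q_def using pos[of u] by (intro mult_nonneg_nonneg divide_nonneg_nonneg add_nonneg_nonneg) auto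
  have int: "set_integrable lborel {- real n..real n} q" for n
    unfolding set_integrable_def by (intro borel_integrable_compact cont) auto
  have "has_bochner_integral lborel q (Re (H x))"
  proof (rule has_bochner_integral_monotone_convergence)
    show "integrable lborel (\<lambda>u. indicator {- real n..real n} u * q u)" for n
      using int[of n] by (simp add: set_integrable_def)
    show "AE u in lborel. mono (\<lambda>n. indicator {- real n..real n} u * q u)"
      by (intro AE_I2 monoI mult_right_mono q0) (auto simp: indicator_def)
    show "AE u in lborel. (\<lambda>n. indicator {- real n..real n} u * q u) \<longlonglongrightarrow> q u"
    proof (intro AE_I2 tendsto_eventually)
      fix u :: real
      obtain N :: nat where N: "\<bar>u\<bar> \<le> real N"
        using real_arch_simple by blast
      show "\<forall>\<^sub>F n in sequentially. indicator {- real n..real n} u * q u = q u"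
        using eventually_ge_at_top[of N]
        by eventually_elim (use N in \<open>auto simp: indicator_def abs_le_iff\<close>)
    qed
    show "q \<in> borel_measurable lborel"
      using cont by (simp add: borel_measurable_continuous_onI)

    \<comment> \<open>The error from the two vertical sides. On the right
      \<open>exp R / |exp R - exp x|\<close> tends to 1, so \<open>B\<close> must tend to 0; on the
      left the denominator tends to \<open>exp x\<close>, so it is enough that
      \<open>exp u * B u\<close> does.\<close>
    define e where "e R = B (-R) * (exp (-R) / \<bar>exp (-R) - exp x\<bar>) + B R * (exp R / \<bar>exp R - exp x\<bar>)" for R
    have "((\<lambda>R. B R * (exp R / \<bar>exp R - exp x\<bar>)) \<longlongrightarrow> 0 * 1) at_top"
      by (intro tendsto_mult top) real_asymp
    moreover have "((\<lambda>u. exp u * B u / \<bar>exp u - exp x\<bar>) \<longlongrightarrow> 0 / \<bar>0 - exp x\<bar>) at_bot"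
      by (intro tendsto_divide bot tendsto_rabs tendsto_diff exp_at_bot tendsto_const) auto
    then have "((\<lambda>R. B (-R) * (exp (-R) / \<bar>exp (-R) - exp x\<bar>)) \<longlongrightarrow> 0) at_top"
      by (simp add: at_bot_mirror filterlim_filtermap mult_ac)
    ultimately have "(e \<longlongrightarrow> 0 + 0 * 1) at_top"
      unfolding e_def by (intro tendsto_add)
    then have lim: "(\<lambda>n. e (real n)) \<longlonglongrightarrow> 0"
      by (auto intro: filterlim_compose[OF _ filterlim_real_sequentially])
    have "(\<lambda>n. (LINT u:{- real n..real n}|lborel. q u) - Re (H x)) \<longlonglongrightarrow> 0"
    proof (rule Lim_null_comparison[OF _ lim])
      show "\<forall>\<^sub>F n in sequentially. norm ((LINT u:{- real n..real n}|lborel. q u) - Re (H x)) \<le> e (real n)"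
        using eventually_gt_at_top[of "nat \<lceil>\<bar>x\<bar>\<rceil>"]
      proof eventually_elim
        case (elim n)
        then have "\<bar>x\<bar> < real n"
          by linarith
        from strip_rectangle_bound[OF holo sym bound this] show ?case
          using set_borel_integral_eq_integral(2)[OF int[of n]]
          by (simp only: e_def real_norm_def flip: q_def)
      qed
    qed
    then show "(\<lambda>n. LINT u|lborel. indicator {- real n..real n} u * q u) \<longlonglongrightarrow> Re (H x)"
      by (simp add: set_lebesgue_integral_def LIM_zero_iff)
  qed
  then show ?thesis
    by (simp only: q_def[abs_def])
qed

section \<open>Completely monotone functions with a density\<close>

text \<open>A single term of the series of \<open>exp (s * t)\<close> is at most the whole
  sum.\<close>

lemma power_exp_minus_le:
  fixes s t :: real
  assumes "s \<ge> 0" "t > 0"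
  shows "s ^ k * exp (- (s * t)) \<le> fact k / t ^ k"
proof -
  have "(s * t) ^ k / fact k \<le> (\<Sum>n. (s * t) ^ n / fact n)"
    using sum_le_suminf[OF summable_exp_generic[of "s * t"], of "{k}"] assms
    by (simp add: scaleR_conv_of_real divide_inverse mult_ac)
  also have "\<dots> = exp (s * t)"
    by (simp add: exp_def scaleR_conv_of_real divide_inverse mult_ac)
  finally show ?thesis
    using assms by (simp add: exp_minus field_simps power_mult_distrib)
qed

text \<open>With \<open>s = exp u\<close> this is the Laplace transform of the measure with density
  \<open>p (ln s) / s\<close> on the half-line, as in Bernstein's theorem.\<close>

definition bernstein_fun :: "(real \<Rightarrow> real) \<Rightarrow> real \<Rightarrow> real" where
  "bernstein_fun p t = (LINT u|lborel. exp (- (exp u * t)) * p u)"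

text \<open>The integrability condition says that the Stieltjes transform, the integral of
  \<open>p u / (exp u + lambda)\<close>, is finite at \<open>lambda = 1\<close>.\<close>

locale bernstein_density =
  fixes p :: "real \<Rightarrow> real"
  assumes meas [measurable]: "p \<in> borel_measurable borel"
    and nonneg: "\<And>u. p u \<ge> 0"
    and integrable: "integrable lborel (\<lambda>u. p u / (exp u + 1))"
begin

text \<open>For fixed \<open>t > 0\<close> the factor in front of \<open>p u\<close>, multiplied by
  \<open>exp u + 1\<close>, is bounded in \<open>u\<close>; so \<open>p u / (exp u + 1)\<close>
  dominates.\<close>

lemma integrable_exp:
  assumes "t > 0"
  shows "integrable lborel (\<lambda>u. exp u ^ k * exp (- (exp u * t)) * p u)"
proof (rule Bochner_Integration.integrable_bound[OF integrable_mult_right[OF integrable]])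
  show "AE u in lborel. norm (exp u ^ k * exp (- (exp u * t)) * p u)
      \<le> norm ((fact (Suc k) / t ^ Suc k + fact k / t ^ k) * (p u / (exp u + 1)))"
  proof (rule AE_I2)
    fix u :: real
    have pos: "exp u + 1 > 0"
      by (simp add: add_pos_pos)
    have "exp u ^ k * exp (- (exp u * t)) * (exp u + 1)
        = exp u ^ Suc k * exp (- (exp u * t)) + exp u ^ k * exp (- (exp u * t))"
      by (simp add: algebra_simps)
    also have "\<dots> \<le> fact (Suc k) / t ^ Suc k + fact k / t ^ k"
      using assms by (intro add_mono power_exp_minus_le) auto
    finally have "exp u ^ k * exp (- (exp u * t)) \<le> (fact (Suc k) / t ^ Suc k + fact k / t ^ k) / (exp u + 1)"
      using pos by (simp only: pos_le_divide_eq)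
    from mult_right_mono[OF this nonneg[of u]]
    have "exp u ^ k * exp (- (exp u * t)) * p u \<le> (fact (Suc k) / t ^ Suc k + fact k / t ^ k) * (p u / (exp u + 1))"
      by simp
    moreover have "0 \<le> exp u ^ k * exp (- (exp u * t)) * p u"
      by (simp add: nonneg)
    ultimately show "norm (exp u ^ k * exp (- (exp u * t)) * p u)
      \<le> norm ((fact (Suc k) / t ^ Suc k + fact k / t ^ k) * (p u / (exp u + 1)))"
      unfolding real_norm_def by (metis abs_ge_self abs_of_nonneg order_trans)
  qed
qed measurable

lemma bernstein_fun_nonneg: "bernstein_fun p t \<ge> 0"
  unfolding bernstein_fun_def by (simp add: nonneg)

lemma bernstein_fun_measurable [measurable]: "bernstein_fun p \<in> borel_measurable borel"
  unfolding bernstein_fun_def by measurable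

lemma bernstein_fun_antimono: "antimono_on {0<..} (bernstein_fun p)"
proof (rule monotone_onI)
  fix s t :: real assume "s \<in> {0<..}" "t \<in> {0<..}" "s \<le> t"
  then show "bernstein_fun p t \<le> bernstein_fun p s"
    unfolding bernstein_fun_def using integrable_exp[of s 0] integrable_exp[of t 0]
    by (intro integral_mono mult_right_mono nonneg) auto
qed

lemma ennreal_bernstein_fun:
  assumes "t > 0"
  shows "ennreal (bernstein_fun p t) = (\<integral>\<^sup>+u. ennreal (exp (- (exp u * t)) * p u) \<partial>lborel)"
  unfolding bernstein_fun_def
  using integrable_exp[OF assms, of 0] by (subst nn_integral_eq_integral) (auto simp: nonneg)

text \<open>Tonelli: integrating \<open>exp (- (exp u + x) * t)\<close> over \<open>t >= 0\<close>
  first gives \<open>1 / (exp u + x)\<close>.\<close>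

lemma nn_laplace_bernstein_fun:
  assumes "x > 0"
  shows "(\<integral>\<^sup>+t. ennreal (exp (- x * t)) * (bernstein_fun p t * indicator {0..} t) \<partial>lborel) =
    (\<integral>\<^sup>+u. ennreal (p u / (exp u + x)) \<partial>lborel)"
proof -
  have "(\<integral>\<^sup>+t. ennreal (exp (- x * t)) * (bernstein_fun p t * indicator {0..} t) \<partial>lborel) =
      (\<integral>\<^sup>+t. \<integral>\<^sup>+u. ennreal (p u) * (ennreal (exp (- (exp u + x) * t)) * indicator {0..} t) \<partial>lborel \<partial>lborel)"
  proof (rule nn_integral_cong_AE)
    \<comment> \<open>At \<open>t = 0\<close> the function \<open>p\<close> itself may fail to be
      integrable, and the Bochner integral then takes the default value 0; this one point is
      discarded.\<close>
    have "AE t in lborel. t \<noteq> (0::real)"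
      by (rule AE_lborel_singleton)
    then show "AE t in lborel. ennreal (exp (- x * t)) * (bernstein_fun p t * indicator {0..} t) =
      (\<integral>\<^sup>+u. ennreal (p u) * (ennreal (exp (- (exp u + x) * t)) * indicator {0..} t) \<partial>lborel)"
    proof eventually_elim
      case (elim t)
      show ?case
      proof (cases "t > 0")
        case True
        have "ennreal (exp (- x * t)) * (bernstein_fun p t * indicator {0..} t)
            = (\<integral>\<^sup>+u. ennreal (exp (- x * t)) * ennreal (exp (- (exp u * t)) * p u) \<partial>lborel)"
          using True by (simp add: ennreal_bernstein_fun nn_integral_cmult)
        also have "\<dots> = (\<integral>\<^sup>+u. ennreal (p u) * (ennreal (exp (- (exp u + x) * t)) * indicator {0..} t) \<partial>lborel)"
        proof (rule nn_integral_cong)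
          fix u
          have "exp (- (exp u + x) * t) = exp (- x * t) * exp (- (exp u * t))"
            by (simp add: exp_add[symmetric] algebra_simps)
          then show "ennreal (exp (- x * t)) * ennreal (exp (- (exp u * t)) * p u) =
              ennreal (p u) * (ennreal (exp (- (exp u + x) * t)) * indicator {0..} t)"
            using True by (simp add: ennreal_mult[symmetric] nonneg mult_ac)
        qed
        finally show ?thesis .
      qed (use elim in auto)
    qed
  qed
  also have "\<dots> = (\<integral>\<^sup>+u. \<integral>\<^sup>+t. ennreal (p u) * (ennreal (exp (- (exp u + x) * t)) * indicator {0..} t) \<partial>lborel \<partial>lborel)"
    by (rule lborel_pair.Fubini') measurable
  also have "\<dots> = (\<integral>\<^sup>+u. ennreal (p u / (exp u + x)) \<partial>lborel)"
  proof (rule nn_integral_cong)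
    fix u
    define y where "y = exp u + x"
    have "y > 0"
      using assms by (simp add: y_def add_pos_pos)
    have "((\<lambda>t. - exp (- y * t) / y) \<longlongrightarrow> 0) at_top"
      using \<open>y > 0\<close> by real_asymp
    moreover have "((\<lambda>t. - exp (- y * t) / y) has_real_derivative exp (- y * t)) (at t)" for t
      using \<open>y > 0\<close> by (auto intro!: derivative_eq_intros)
    ultimately have "(\<integral>\<^sup>+t. ennreal (exp (- y * t)) * indicator {0..} t \<partial>lborel) = ennreal (1 / y)"
      using \<open>y > 0\<close> by (subst nn_integral_FTC_atLeast[where F = "\<lambda>t. - exp (- y * t) / y" and T = 0]) auto
    moreover have "ennreal (p u) * ennreal (1 / y) = ennreal (p u / y)"
      using \<open>y > 0\<close> by (simp add: ennreal_mult[symmetric] nonneg)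
    ultimately show "(\<integral>\<^sup>+t. ennreal (p u) * (ennreal (exp (- (exp u + x) * t)) * indicator {0..} t) \<partial>lborel)
        = ennreal (p u / (exp u + x))"
      unfolding y_def[symmetric] by (simp add: nn_integral_cmult)
  qed
  finally show ?thesis .
qed

lemma laplace_bernstein_fun:
  assumes "x > 0"
  shows "laplace (bernstein_fun p) x = (LINT u|lborel. p u / (exp u + x))"
proof -
  have "laplace (bernstein_fun p) x = (LINT t|lborel. indicator {0..} t *\<^sub>R (exp (- x * t) * bernstein_fun p t))"
    unfolding laplace_def set_lebesgue_integral_def by (rule integral_completion) measurable
  also have "\<dots> = enn2real (\<integral>\<^sup>+t. ennreal (indicator {0..} t *\<^sub>R (exp (- x * t) * bernstein_fun p t)) \<partial>lborel)"
    by (rule integral_eq_nn_integral) (auto simp: bernstein_fun_nonneg)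
  also have "(\<integral>\<^sup>+t. ennreal (indicator {0..} t *\<^sub>R (exp (- x * t) * bernstein_fun p t)) \<partial>lborel) =
      (\<integral>\<^sup>+t. ennreal (exp (- x * t)) * (bernstein_fun p t * indicator {0..} t) \<partial>lborel)"
    by (intro nn_integral_cong) (auto simp: indicator_def ennreal_mult bernstein_fun_nonneg)
  also have "\<dots> = (\<integral>\<^sup>+u. ennreal (p u / (exp u + x)) \<partial>lborel)"
    by (rule nn_laplace_bernstein_fun[OF assms])
  also have "enn2real \<dots> = (LINT u|lborel. p u / (exp u + x))"
    using assms by (intro integral_eq_nn_integral[symmetric]) (auto intro!: divide_nonneg_pos nonneg add_pos_pos)
  finally show ?thesis .
qed

text \<open>On [0, T] the factor \<open>exp (T - t)\<close> is at least 1, so the integral is at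
  most \<open>exp T\<close> times the Laplace transform at 1.\<close>

lemma loc_integrable_bernstein_fun: "loc_integrable (bernstein_fun p)"
  unfolding loc_integrable_def set_integrable_def
proof (intro allI impI integrable_completion[THEN iffD2])
  fix T :: real assume "T \<ge> 0"
  show "integrable lborel (\<lambda>t. indicator {0..T} t *\<^sub>R bernstein_fun p t)"
  proof (rule integrableI_bounded)
    have "(\<integral>\<^sup>+t. ennreal (norm (indicator {0..T} t *\<^sub>R bernstein_fun p t)) \<partial>lborel) \<le>
        (\<integral>\<^sup>+t. ennreal (exp T) * (ennreal (exp (- 1 * t)) * (bernstein_fun p t * indicator {0..} t)) \<partial>lborel)"
    proof (rule nn_integral_mono)
      fix t :: real
      show "ennreal (norm (indicator {0..T} t *\<^sub>R bernstein_fun p t)) \<le>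
        ennreal (exp T) * (ennreal (exp (- 1 * t)) * (bernstein_fun p t * indicator {0..} t))"
      proof (cases "t \<in> {0..T}")
        case True
        then have "1 * bernstein_fun p t \<le> exp (T - t) * bernstein_fun p t"
          by (intro mult_right_mono bernstein_fun_nonneg) simp
        with True show ?thesis
          by (simp add: ennreal_mult[symmetric] bernstein_fun_nonneg exp_diff exp_minus field_simps ennreal_leI)
      qed simp
    qed
    also have "\<dots> = ennreal (exp T) * (\<integral>\<^sup>+u. ennreal (p u / (exp u + 1)) \<partial>lborel)"
      by (subst nn_integral_cmult, measurable, subst nn_laplace_bernstein_fun) simp_all
    also have "\<dots> < \<infinity>"
      using integrable by (auto simp: integrable_iff_bounded nonneg ennreal_mult_less_top add_nonneg_nonneg)
    finally show "(\<integral>\<^sup>+t. ennreal (norm (indicator {0..T} t *\<^sub>R bernstein_fun p t)) \<partial>lborel) < \<infinity>" .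
  qed measurable
qed measurable

text \<open>Differentiation under the integral by an explicit estimate: the difference quotient
  misses the derivative by at most \<open>K * |h|\<close>.\<close>

lemma has_real_derivative_bernstein_fun:
  assumes "t > 0"
  shows "((\<lambda>t. LINT u|lborel. (- exp u) ^ k * exp (- (exp u * t)) * p u) has_real_derivative
    (LINT u|lborel. (- exp u) ^ Suc k * exp (- (exp u * t)) * p u)) (at t)"
proof -
  define D where "D k t = (LINT u|lborel. (- exp u) ^ k * exp (- (exp u * t)) * p u)" for k t
  \<comment> \<open>The second-order remainder brings two more factors \<open>exp u\<close>. For
    \<open>|h| < t / 2\<close> it costs at most \<open>exp (exp u * (t / 2))\<close>, which leaves
    decay at rate \<open>t / 2\<close>.\<close>
  define K where "K = (LINT u|lborel. exp u ^ (k + 2) * exp (- (exp u * (t / 2))) * p u)"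
  have int: "integrable lborel (\<lambda>u. (- exp u) ^ k * exp (- (exp u * t)) * p u)" if "t > 0" for k t
  proof -
    have "(\<lambda>u. (- exp u) ^ k * exp (- (exp u * t)) * p u) = (\<lambda>u. (- 1) ^ k * (exp u ^ k * exp (- (exp u * t)) * p u))"
      by (simp add: power_minus[of "exp _"] mult_ac fun_eq_iff)
    then show ?thesis
      using integrable_exp[OF that] by simp
  qed
  have bound: "\<bar>(D k (t + h) - D k t) / h - D (Suc k) t\<bar> \<le> K * \<bar>h\<bar>" if h: "h \<noteq> 0" "\<bar>h\<bar> < t / 2" for h
  proof -
    have "t + h > 0"
      using h assms by linarith
    define r where "r u = (- exp u) ^ k * exp (- (exp u * (t + h))) * p u - (- exp u) ^ k * exp (- (exp u * t)) * p u
        - h * ((- exp u) ^ Suc k * exp (- (exp u * t)) * p u)" for u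
    note i1 = int[OF \<open>t + h > 0\<close>, of k] and i2 = int[OF assms, of k]
    have i3: "integrable lborel (\<lambda>u. h * ((- exp u) ^ Suc k * exp (- (exp u * t)) * p u))"
      by (rule integrable_mult_right[OF int[OF assms]])
    have r_int: "integrable lborel r"
      unfolding r_def[abs_def]
      by (rule Bochner_Integration.integrable_diff[OF Bochner_Integration.integrable_diff[OF i1 i2] i3])
    have "\<bar>r u\<bar> \<le> h\<^sup>2 * (exp u ^ (k + 2) * exp (- (exp u * (t / 2))) * p u)" for u
    proof -
      define y where "y = - (exp u * h)"
      have "\<bar>exp y - 1 - y\<bar> \<le> exp \<bar>y\<bar> * y\<^sup>2"
      proof -
        \<comment> \<open>\<open>Taylor_exp\<close> bounds the remainder of the complex exponential,
          so \<open>y\<close> is embedded into the complex numbers.\<close>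
        have "exp (of_real y) - (\<Sum>k\<le>1. of_real y ^ k / fact k) = complex_of_real (exp y - 1 - y)"
          by (simp add: exp_of_real)
        then have "cmod (complex_of_real (exp y - 1 - y)) \<le> exp \<bar>y\<bar> * y\<^sup>2"
          using Taylor_exp[of "of_real y" 1] by (simp add: power2_eq_square diff_diff_eq)
        then show ?thesis
          by (simp only: norm_of_real real_norm_def)
      qed
      also have "\<dots> \<le> exp (exp u * (t / 2)) * y\<^sup>2"
        using h by (intro mult_right_mono) (auto simp: y_def abs_mult intro!: mult_left_mono)
      finally have *: "\<bar>exp y - 1 - y\<bar> \<le> exp (exp u * (t / 2)) * y\<^sup>2" .
      have "r u = (- exp u) ^ k * exp (- (exp u * t)) * p u * (exp y - 1 - y)"
      proof -
        have "exp (- (exp u * (t + h))) = exp (- (exp u * t)) * exp y"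
          by (simp add: y_def exp_add[symmetric] algebra_simps)
        then show ?thesis
          by (simp add: r_def) (simp add: y_def algebra_simps)
      qed
      then have "\<bar>r u\<bar> = exp u ^ k * exp (- (exp u * t)) * p u * \<bar>exp y - 1 - y\<bar>"
        by (simp add: abs_mult power_abs nonneg)
      also have "\<dots> \<le> exp u ^ k * exp (- (exp u * t)) * p u * (exp (exp u * (t / 2)) * y\<^sup>2)"
        by (intro mult_left_mono *) (simp add: nonneg)
      also have "\<dots> = h\<^sup>2 * (exp u ^ (k + 2) * (exp (- (exp u * t)) * exp (exp u * (t / 2))) * p u)"
        by (simp add: y_def power2_eq_square)
      also have "exp (- (exp u * t)) * exp (exp u * (t / 2)) = exp (- (exp u * (t / 2)))"
        by (simp flip: exp_add)
      finally show ?thesis .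
    qed
    then have "\<bar>LINT u|lborel. r u\<bar> \<le> (LINT u|lborel. h\<^sup>2 * (exp u ^ (k + 2) * exp (- (exp u * (t / 2))) * p u))"
      using integrable_exp[of "t / 2" "k + 2"] assms r_int
      by (intro order_trans[OF integral_abs_bound] integral_mono) auto
    also have "\<dots> = h\<^sup>2 * K"
      by (simp add: K_def)
    also have "(LINT u|lborel. r u) = D k (t + h) - D k t - h * D (Suc k) t"
      unfolding r_def D_def
      by (simp only: Bochner_Integration.integral_diff Bochner_Integration.integrable_diff i1 i2 i3 integral_mult_right_zero)
    also have "\<dots> = h * ((D k (t + h) - D k t) / h - D (Suc k) t)"
      using h by (subst right_diff_distrib) simp
    finally have "\<bar>h\<bar> * \<bar>(D k (t + h) - D k t) / h - D (Suc k) t\<bar> \<le> \<bar>h\<bar> * (K * \<bar>h\<bar>)"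
      by (simp add: abs_mult power2_eq_square mult_ac)
    then show ?thesis
      using h by simp
  qed
  have "((\<lambda>h. (D k (t + h) - D k t) / h - D (Suc k) t) \<longlongrightarrow> 0) (at 0)"
  proof (rule Lim_null_comparison)
    show "\<forall>\<^sub>F h in at 0. norm ((D k (t + h) - D k t) / h - D (Suc k) t) \<le> K * \<bar>h\<bar>"
      unfolding eventually_at using bound assms by (intro exI[of _ "t / 2"]) auto
    show "((\<lambda>h. K * \<bar>h\<bar>) \<longlongrightarrow> 0) (at 0)"
      by (auto intro!: tendsto_eq_intros)
  qed
  then have "((\<lambda>h. (D k (t + h) - D k t) / h) \<longlongrightarrow> D (Suc k) t) (at 0)"
    by (simp add: LIM_zero_iff)
  then show ?thesis
    by (simp only: DERIV_def D_def)
qed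

lemma completely_monotone_bernstein_fun: "completely_monotone (bernstein_fun p)"
proof -
  define D where "D k t = (LINT u|lborel. (- exp u) ^ k * exp (- (exp u * t)) * p u)" for k t
  have D: "(D k has_real_derivative D (Suc k) t) (at t)" if "t > 0" for k t
    unfolding D_def by (rule has_real_derivative_bernstein_fun[OF that])
  \<comment> \<open>The two functions are compared only for \<open>t > 0\<close>. The induction
    therefore carries the derivative along and transfers it on the open half-line.\<close>
  have *: "\<forall>t>0. (deriv ^^ k) (bernstein_fun p) t = D k t \<and>
    ((deriv ^^ k) (bernstein_fun p) has_real_derivative D (Suc k) t) (at t)" for k
  proof (induction k)
    case 0
    have "bernstein_fun p = D 0"
      by (simp add: D_def bernstein_fun_def fun_eq_iff)
    then show ?case
      using D[of _ 0] by simp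
  next
    case (Suc k)
    then have eq: "(deriv ^^ Suc k) (bernstein_fun p) t = D (Suc k) t" if "t > 0" for t
      using that by (auto intro!: DERIV_imp_deriv)
    moreover have "((deriv ^^ Suc k) (bernstein_fun p) has_real_derivative D (Suc (Suc k)) t) (at t)" if "t > 0" for t
      by (rule has_field_derivative_transform_within_open[OF D[OF that], of "{0<..}"]) (use that eq in auto)
    ultimately show ?case
      by blast
  qed
  show ?thesis
    unfolding completely_monotone_def
  proof (intro allI impI conjI)
    fix k :: nat and t :: real assume "t > 0"
    then show "(deriv ^^ k) (bernstein_fun p) differentiable at t"
      using * by (auto simp: real_differentiable_def)
    have "(- 1) ^ k * D k t = (LINT u|lborel. (- 1) ^ k * ((- exp u) ^ k * exp (- (exp u * t)) * p u))"
      by (simp add: D_def)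
    also have "\<dots> = (LINT u|lborel. exp u ^ k * exp (- (exp u * t)) * p u)"
      by (intro Bochner_Integration.integral_cong) (simp_all flip: power_mult_distrib mult.assoc)
    also have "\<dots> \<ge> 0"
      by (simp add: nonneg)
    finally show "0 \<le> (- 1) ^ k * (deriv ^^ k) (bernstein_fun p) t"
      using * \<open>t > 0\<close> by simp
  qed
qed

end

section \<open>Uniqueness of the Laplace transform and the convolution equation\<close>

text \<open>The absolute moments of a distribution on [-1, 1] are at most 1, which makes the Taylor
  remainder of its characteristic function explicit.\<close>

lemma (in real_distribution) char_moments:
  assumes "AE x in M. \<bar>x\<bar> \<le> 1"
  shows "cmod (char M t - (\<Sum>k\<le>n. (\<i> * t) ^ k / fact k * expectation (\<lambda>x. x ^ k))) \<le> 2 * \<bar>t\<bar> ^ n / fact n"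
proof -
  have bdd: "AE x in M. norm (x ^ k) \<le> 1" for k :: nat
    using assms by eventually_elim (simp add: power_abs power_le_one)
  have int: "integrable M (\<lambda>x. x ^ k)" for k :: nat
    by (rule integrable_const_bound[OF bdd]) simp
  have "expectation (\<lambda>x. \<bar>x\<bar> ^ n) \<le> expectation (\<lambda>_. 1)"
    using bdd[of n] integrable_abs[OF int[of n]] by (intro integral_mono_AE) (simp_all add: power_abs)
  then have "expectation (\<lambda>x. \<bar>x\<bar> ^ n) \<le> 1"
    using prob_space by simp
  then have "2 * \<bar>t\<bar> ^ n / fact n * expectation (\<lambda>x. \<bar>x\<bar> ^ n) \<le> 2 * \<bar>t\<bar> ^ n / fact n * 1"
    by (intro mult_left_mono) simp_all
  then show ?thesis
    using char_approx1[of n t] int by simp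
qed

text \<open>Determinacy of the Hausdorff moment problem: equal moments give equal Taylor
  polynomials, so the characteristic functions differ by at most \<open>4 * |t| ^ n / fact n\<close>
  for every \<open>n\<close>.\<close>

lemma moments_unique:
  assumes "real_distribution M" "real_distribution M'"
    and "AE x in M. \<bar>x\<bar> \<le> 1" "AE x in M'. \<bar>x\<bar> \<le> 1"
    and eq: "\<And>k::nat. (LINT x|M. x ^ k) = (LINT x|M'. x ^ k)"
  shows "M = M'"
proof (rule Levy_uniqueness[OF assms(1,2)], rule ext)
  fix t
  have "cmod (char M t - char M' t) \<le> 4 * (inverse (fact n) * \<bar>t\<bar> ^ n)" for n
  proof -
    have "cmod (char M t - char M' t) \<le> 2 * \<bar>t\<bar> ^ n / fact n + 2 * \<bar>t\<bar> ^ n / fact n"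
      by (rule norm_diff_triangle_le[OF real_distribution.char_moments[OF assms(1,3), of t n, unfolded eq]])
         (subst norm_minus_commute, rule real_distribution.char_moments[OF assms(2,4)])
    then show ?thesis
      by (simp add: field_simps)
  qed
  then have "\<exists>N. \<forall>n\<ge>N. cmod (char M t - char M' t) \<le> 4 * (inverse (fact n) * \<bar>t\<bar> ^ n)"
    by blast
  moreover have "(\<lambda>n. 4 * (inverse (fact n) * \<bar>t\<bar> ^ n)) \<longlonglongrightarrow> 4 * 0"
    by (intro tendsto_mult tendsto_const summable_LIMSEQ_zero summable_exp)
  ultimately have "cmod (char M t - char M' t) \<le> 4 * 0"
    by (intro LIMSEQ_le_const)
  then show "char M t = char M' t"
    by simp
qed

text \<open>Under \<open>x = exp (- t)\<close> the transform at \<open>1 + k\<close> becomes the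
  \<open>k\<close>-th moment of a measure on (0, 1], and \<open>one\<close> makes it a probability.
  So the positive integers as arguments suffice.\<close>

lemma laplace_unique_AE:
  fixes f g :: "real \<Rightarrow> ennreal"
  assumes [measurable]: "f \<in> borel_measurable borel" "g \<in> borel_measurable borel"
    and supp: "\<And>t. t < 0 \<Longrightarrow> f t = 0" "\<And>t. t < 0 \<Longrightarrow> g t = 0"
    and eq: "\<And>k::nat. (\<integral>\<^sup>+t. ennreal (exp (- (1 + k) * t)) * f t \<partial>lborel) =
                    (\<integral>\<^sup>+t. ennreal (exp (- (1 + k) * t)) * g t \<partial>lborel)"
    and one: "(\<integral>\<^sup>+t. ennreal (exp (- t)) * f t \<partial>lborel) = 1"
  shows "AE t in lborel. f t = g t"
proof -
  define \<mu> where "\<mu> h = density lborel (\<lambda>t. ennreal (exp (- t)) * h t)" for h :: "real \<Rightarrow> ennreal"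
  have [simp, measurable_cong]: "sets (\<mu> h) = sets borel" for h
    by (simp add: \<mu>_def)
  define \<nu> where "\<nu> h = distr (\<mu> h) borel (\<lambda>t. exp (- t))" for h
  have props: "real_distribution (\<nu> h) \<and> (AE x in \<nu> h. \<bar>x\<bar> \<le> 1) \<and>
      (\<forall>k::nat. (LINT x|\<nu> h. x ^ k) = enn2real (\<integral>\<^sup>+t. ennreal (exp (- (1 + k) * t)) * h t \<partial>lborel))"
    if [measurable]: "h \<in> borel_measurable borel" and supp: "\<And>t. t < 0 \<Longrightarrow> h t = 0"
      and one: "(\<integral>\<^sup>+t. ennreal (exp (- t)) * h t \<partial>lborel) = 1" for h
  proof (intro conjI allI)
    interpret prob_space "\<mu> h"
      by (rule prob_spaceI) (simp add: \<mu>_def emeasure_density one)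
    show "real_distribution (\<nu> h)"
      unfolding \<nu>_def by (rule real_distribution_distr) measurable
    show ae: "AE x in \<nu> h. \<bar>x\<bar> \<le> 1"
    proof -
      have "AE t in \<mu> h. t \<ge> 0"
        unfolding \<mu>_def by (subst AE_density) (auto intro!: AE_I2 simp: supp[OF not_le_imp_less] less_le_not_le intro: leI)
      then show ?thesis
        unfolding \<nu>_def by (subst AE_distr_iff) auto
    qed
    fix k :: nat
    have "(LINT x|\<nu> h. x ^ k) = (LINT t|\<mu> h. exp (- t) ^ k)"
      unfolding \<nu>_def by (subst integral_distr) auto
    also have "\<dots> = enn2real (\<integral>\<^sup>+t. ennreal (exp (- t) ^ k) \<partial>\<mu> h)"
      by (rule integral_eq_nn_integral) auto
    also have "(\<integral>\<^sup>+t. ennreal (exp (- t) ^ k) \<partial>\<mu> h) = (\<integral>\<^sup>+t. ennreal (exp (- t)) * h t * ennreal (exp (- t) ^ k) \<partial>lborel)"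
      unfolding \<mu>_def by (rule nn_integral_density) auto
    also have "\<dots> = (\<integral>\<^sup>+t. ennreal (exp (- (1 + k) * t)) * h t \<partial>lborel)"
    proof (rule nn_integral_cong)
      fix t :: real
      have "exp (- (1 + k) * t) = exp (- t) * exp (- t) ^ k"
        by (simp add: exp_of_nat_mult[symmetric] exp_add[symmetric] algebra_simps)
      then show "ennreal (exp (- t)) * h t * ennreal (exp (- t) ^ k) = ennreal (exp (- (1 + k) * t)) * h t"
        by (simp add: ennreal_mult mult_ac)
    qed
    finally show "(LINT x|\<nu> h. x ^ k) = enn2real (\<integral>\<^sup>+t. ennreal (exp (- (1 + k) * t)) * h t \<partial>lborel)" .
  qed
  have "(\<integral>\<^sup>+t. ennreal (exp (- t)) * g t \<partial>lborel) = 1"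
    using eq[of 0] one by simp
  with props[of f] props[of g] supp one eq have "\<nu> f = \<nu> g"
    by (intro moments_unique) auto
  \<comment> \<open>The map \<open>- ln\<close> undoes the substitution and recovers the measures on
    the time axis.\<close>
  moreover have "distr (\<nu> h) borel (\<lambda>x. - ln x) = \<mu> h" for h
    unfolding \<nu>_def by (subst distr_distr) (auto simp: o_def intro!: distr_id2)
  ultimately have "\<mu> f = \<mu> g"
    by metis
  then have "AE t in lborel. ennreal (exp (- t)) * f t = ennreal (exp (- t)) * g t"
    unfolding \<mu>_def by (intro sigma_finite_measure.density_unique[OF sigma_finite_lborel]) auto
  then show ?thesis
    by eventually_elim (simp add: ennreal_mult_cancel_left)
qed

section \<open>The convolution equation\<close>

text \<open>Split \<open>exp (- x * t)\<close> at \<open>s\<close>, exchange the integrals, and use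
  translation invariance in the inner one.\<close>

lemma nn_integral_laplace_convolution:
  fixes F G :: "real \<Rightarrow> ennreal"
  assumes [measurable]: "F \<in> borel_measurable borel" "G \<in> borel_measurable borel"
  shows "(\<integral>\<^sup>+t. ennreal (exp (- x * t)) * (\<integral>\<^sup>+s. F (t - s) * G s \<partial>lborel) \<partial>lborel) =
    (\<integral>\<^sup>+t. ennreal (exp (- x * t)) * F t \<partial>lborel) * (\<integral>\<^sup>+t. ennreal (exp (- x * t)) * G t \<partial>lborel)"
proof -
  have "(\<integral>\<^sup>+t. ennreal (exp (- x * t)) * (\<integral>\<^sup>+s. F (t - s) * G s \<partial>lborel) \<partial>lborel) =
     (\<integral>\<^sup>+t. \<integral>\<^sup>+s. (ennreal (exp (- x * s)) * G s) * (ennreal (exp (- x * (t - s))) * F (t - s)) \<partial>lborel \<partial>lborel)"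
  proof (subst nn_integral_cmult[symmetric], measurable, intro nn_integral_cong)
    fix t s
    have "exp (- x * t) = exp (- x * s) * exp (- x * (t - s))"
      by (simp add: exp_add[symmetric] algebra_simps)
    then show "ennreal (exp (- x * t)) * (F (t - s) * G s) =
        (ennreal (exp (- x * s)) * G s) * (ennreal (exp (- x * (t - s))) * F (t - s))"
      by (simp add: ennreal_mult mult_ac)
  qed
  also have "\<dots> = (\<integral>\<^sup>+s. \<integral>\<^sup>+t. (ennreal (exp (- x * s)) * G s) * (ennreal (exp (- x * (t - s))) * F (t - s)) \<partial>lborel \<partial>lborel)"
    by (rule lborel_pair.Fubini') measurable
  also have "\<dots> = (\<integral>\<^sup>+s. (ennreal (exp (- x * s)) * G s) * (\<integral>\<^sup>+t. ennreal (exp (- x * t)) * F t \<partial>lborel) \<partial>lborel)"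
  proof (rule nn_integral_cong)
    fix s
    have "(\<integral>\<^sup>+t. ennreal (exp (- x * t)) * F t \<partial>lborel) = (\<integral>\<^sup>+t. ennreal (exp (- x * (t - s))) * F (t - s) \<partial>lborel)"
      by (subst nn_integral_real_affine[of _ 1 "- s"]) (auto simp: algebra_simps)
    then show "(\<integral>\<^sup>+t. (ennreal (exp (- x * s)) * G s) * (ennreal (exp (- x * (t - s))) * F (t - s)) \<partial>lborel) =
        (ennreal (exp (- x * s)) * G s) * (\<integral>\<^sup>+t. ennreal (exp (- x * t)) * F t \<partial>lborel)"
      by (simp add: nn_integral_cmult)
  qed
  also have "\<dots> = (\<integral>\<^sup>+t. ennreal (exp (- x * t)) * F t \<partial>lborel) * (\<integral>\<^sup>+t. ennreal (exp (- x * t)) * G t \<partial>lborel)"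
    by (subst nn_integral_multc) (simp_all add: mult.commute)
  finally show ?thesis .
qed

lemma AE_lborel_dense:
  assumes "AE t in lborel. P t" "a < (b::real)"
  obtains s where "a < s" "s < b" "P s"
proof -
  have "\<exists>s\<in>{a<..<b}. P s"
  proof (rule ccontr)
    assume "\<not> (\<exists>s\<in>{a<..<b}. P s)"
    then have "AE t in lborel. t \<notin> {a<..<b}"
      using assms(1) by (auto elim!: eventually_mono)
    then have "{a<..<b} \<in> null_sets lborel"
      by (subst AE_iff_null_sets) auto
    then show False
      using assms(2) by (auto simp: null_sets_def)
  qed
  then show thesis
    using that by auto
qed

text \<open>
  \<open>F * G = 1\<close> only almost everywhere at first; but \<open>(F * G)(t) / t = \<integral>\<^sub>0\<^sup>1 F (t (1 - y)) G (t y) dy\<close>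
  is monotone in \<open>t\<close>.
\<close>

lemma convolution_eq_1:
  fixes f g :: "real \<Rightarrow> real"
  assumes [measurable]: "f \<in> borel_measurable borel" "g \<in> borel_measurable borel"
    and nonneg: "\<And>t. 0 \<le> f t" "\<And>t. 0 \<le> g t"
    and mono: "antimono_on {0<..} f" "antimono_on {0<..} g"
    and laplace: "\<And>x. x > 0 \<Longrightarrow> (\<integral>\<^sup>+t. ennreal (exp (- x * t)) * (f t * indicator {0..} t) \<partial>lborel) *
      (\<integral>\<^sup>+t. ennreal (exp (- x * t)) * (g t * indicator {0..} t) \<partial>lborel) = ennreal (1 / x)"
    and "t > 0"
  shows "Defs.convolution f g t = 1"
proof -
  \<comment> \<open>Cutting off at 0 turns the integral over [0, t] into the whole-line convolution
    \<open>c\<close>; for \<open>t > 0\<close> the substitution \<open>s = t * y\<close> gives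
    \<open>c t = t * d t\<close>.\<close>
  define F G where "F t = ennreal (f t * indicator {0..} t)" and "G t = ennreal (g t * indicator {0..} t)" for t
  have [measurable]: "F \<in> borel_measurable borel" "G \<in> borel_measurable borel"
    unfolding F_def G_def by measurable
  define c where "c t = (\<integral>\<^sup>+s. F (t - s) * G s \<partial>lborel)" for t
  define d where "d t = (\<integral>\<^sup>+y. F (t - t * y) * G (t * y) \<partial>lborel)" for t
  have [measurable]: "c \<in> borel_measurable borel"
    unfolding c_def by measurable
  have one: "(\<integral>\<^sup>+t. ennreal (exp (- x * t)) * indicator {0..} t \<partial>lborel) = ennreal (1 / x)"
    if "x > 0" for x :: real
  proof -
    have "((\<lambda>t. - exp (- x * t) / x) \<longlongrightarrow> 0) at_top"
      using that by real_asymp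
    moreover have "((\<lambda>t. - exp (- x * t) / x) has_real_derivative exp (- x * t)) (at t)" for t
      using that by (auto intro!: derivative_eq_intros)
    ultimately show ?thesis
      using that by (subst nn_integral_FTC_atLeast[where F = "\<lambda>t. - exp (- x * t) / x" and T = 0]) auto
  qed
  have lap: "(\<integral>\<^sup>+t. ennreal (exp (- x * t)) * c t \<partial>lborel) = ennreal (1 / x)" if "x > 0" for x
    unfolding c_def by (subst nn_integral_laplace_convolution) (use laplace[OF that] in \<open>simp_all add: F_def G_def\<close>)
  have "AE t in lborel. c t = indicator {0..} t"
  proof (rule laplace_unique_AE)
    fix t :: real assume "t < 0"
    then have "F (t - s) * G s = 0" for s
      by (auto simp: F_def G_def indicator_def)
    then show "c t = 0"
      by (simp only: c_def) simp
  next
    show "(\<integral>\<^sup>+t. ennreal (exp (- (1 + real k) * t)) * c t \<partial>lborel) =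
      (\<integral>\<^sup>+t. ennreal (exp (- (1 + real k) * t)) * indicator {0..} t \<partial>lborel)" for k :: nat
      using lap[of "1 + k"] one[of "1 + k"] by simp
    show "(\<integral>\<^sup>+t. ennreal (exp (- t)) * c t \<partial>lborel) = 1"
      using lap[of 1] by simp
  qed (auto simp: indicator_def)
  moreover have cd: "c t = ennreal t * d t" if "t > 0" for t
    unfolding c_def d_def
    using nn_integral_real_affine[of "\<lambda>s. F (t - s) * G s" t 0] that by simp
  ultimately have ae: "AE t in lborel. t > 0 \<longrightarrow> ennreal t * d t = 1"
    by (auto elim!: eventually_mono simp: indicator_def)
  have d_mono: "d t' \<le> d t" if "0 < t" "t \<le> t'" for t t'
    unfolding d_def
  proof (rule nn_integral_mono)
    fix y :: real
    have Fle: "F b \<le> F a" if "0 < a" "a \<le> b" for a b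
      using monotone_onD[OF mono(1), of a b] that by (auto simp: F_def ennreal_leI)
    have Gle: "G b \<le> G a" if "0 < a" "a \<le> b" for a b
      using monotone_onD[OF mono(2), of a b] that by (auto simp: G_def ennreal_leI)
    \<comment> \<open>For \<open>y\<close> in (0, 1) both factors decrease in \<open>t\<close>. At
      \<open>y = 0\<close> and \<open>y = 1\<close> one argument is 0 for both times, so that factor
      agrees; outside [0, 1] one factor vanishes.\<close>
    consider "y < 0" | "y = 0" | "0 < y" "y < 1" | "y = 1" | "y > 1"
      by fastforce
    then show "F (t' - t' * y) * G (t' * y) \<le> F (t - t * y) * G (t * y)"
    proof cases
      case 1
      with that have "t' * y < 0" "t * y < 0"
        by (auto intro!: mult_pos_neg)
      then show ?thesis by (simp add: G_def)
    next
      case 2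
      with that show ?thesis by (auto intro!: mult_right_mono Fle)
    next
      case 3
      have "0 < t * (1 - y)" "t * (1 - y) \<le> t' * (1 - y)" "0 < t * y" "t * y \<le> t' * y"
        using that 3 by (auto intro!: mult_pos_pos mult_right_mono)
      then have "F (t' * (1 - y)) * G (t' * y) \<le> F (t * (1 - y)) * G (t * y)"
        by (rule mult_mono[OF Fle Gle]) simp_all
      then show ?thesis
        by (simp add: right_diff_distrib)
    next
      case 4
      with that show ?thesis by (auto intro!: mult_left_mono Gle)
    next
      case 5
      then have "t' * (1 - y) < 0"
        using that by (intro mult_pos_neg) auto
      then show ?thesis by (simp add: F_def algebra_simps)
    qed
  qed
  have d_eq: "d s = ennreal (1 / s)" if "s > 0" "ennreal s * d s = 1" for s
  proof -
    have "d s \<noteq> top"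
      using that by (auto simp: ennreal_mult_top)
    then obtain r where "r \<ge> 0" "d s = ennreal r"
      by (cases "d s") auto
    then show ?thesis
      using that by (simp add: ennreal_mult[symmetric] ennreal_eq_1 field_simps)
  qed
  have dense: "\<exists>s. a < s \<and> s < b \<and> d s = ennreal (1 / s)" if "0 < a" "a < b" for a b
  proof -
    obtain s where "a < s" "s < b" "s > 0 \<longrightarrow> ennreal s * d s = 1"
      by (rule AE_lborel_dense[OF ae \<open>a < b\<close>])
    with that d_eq[of s] show ?thesis
      by auto
  qed
  have "d t = ennreal (1 / t)"
  proof -
    \<comment> \<open>Monotonicity from an earlier good point makes \<open>d t\<close>
      finite.\<close>
    obtain s0 where "t / 2 < s0" "s0 < t" "d s0 = ennreal (1 / s0)"
      using dense[of "t / 2" t] \<open>t > 0\<close> by auto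
    then have "d t \<le> ennreal (1 / s0)"
      using d_mono[of s0 t] \<open>t > 0\<close> by auto
    then obtain r where r: "r \<ge> 0" "d t = ennreal r"
      by (cases "d t") (auto simp: top_unique)
    \<comment> \<open>Squeeze by good points: one in \<open>(z * t, t)\<close> bounds
      \<open>r\<close> from above, one in \<open>(t, t / z)\<close> from below, for every
      \<open>z\<close> in (0, 1).\<close>
    have "r \<le> 1 / t"
    proof (rule field_le_mult_one_interval)
      fix z :: real assume z: "0 < z" "z < 1"
      then have zt: "0 < z * t" "z * t < t"
        using \<open>t > 0\<close> by simp_all
      obtain s where s: "z * t < s" "s < t" "d s = ennreal (1 / s)"
        using dense[OF zt] by blast
      have "s > 0"
        using s zt by linarith
      then have "ennreal r \<le> ennreal (1 / s)"
        using d_mono[of s t] s r by simp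
      then have "r \<le> 1 / s"
        using \<open>s > 0\<close> by simp
      also have "\<dots> \<le> 1 / (z * t)"
        using s zt \<open>s > 0\<close> \<open>0 < z\<close> \<open>t > 0\<close> by (intro divide_left_mono mult_pos_pos) auto
      finally have "z * r \<le> z * (1 / (z * t))"
        using z by (intro mult_left_mono) auto
      then show "z * r \<le> 1 / t"
        using z by simp
    qed
    moreover have "1 / t \<le> r"
    proof (rule field_le_mult_one_interval)
      fix z :: real assume z: "0 < z" "z < 1"
      then have zt: "t < t / z"
        using \<open>t > 0\<close> by (simp add: pos_less_divide_eq)
      obtain s where s: "t < s" "s < t / z" "d s = ennreal (1 / s)"
        using dense[OF \<open>t > 0\<close> zt] by blast
      have "s > 0"
        using s \<open>t > 0\<close> by linarith
      have "1 / (t / z) \<le> 1 / s"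
        using s \<open>s > 0\<close> z \<open>t > 0\<close> by (intro divide_left_mono mult_pos_pos) auto
      moreover have "ennreal (1 / s) \<le> ennreal r"
        using d_mono[of t s] s r \<open>t > 0\<close> by simp
      then have "1 / s \<le> r"
        using r by simp
      ultimately show "z * (1 / t) \<le> r"
        by simp
    qed
    ultimately show ?thesis
      using r by simp
  qed
  then have "c t = 1"
    using cd[OF \<open>t > 0\<close>] \<open>t > 0\<close> by (simp add: ennreal_mult[symmetric])
  have "Defs.convolution f g t = (LINT s|lborel. indicator {0..t} s *\<^sub>R (f (t - s) * g s))"
    unfolding Defs.convolution_def set_lebesgue_integral_def by (rule integral_completion) measurable
  also have "\<dots> = enn2real (\<integral>\<^sup>+s. ennreal (indicator {0..t} s *\<^sub>R (f (t - s) * g s)) \<partial>lborel)"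
    by (rule integral_eq_nn_integral) (auto simp: nonneg)
  also have "(\<integral>\<^sup>+s. ennreal (indicator {0..t} s *\<^sub>R (f (t - s) * g s)) \<partial>lborel) = c t"
    unfolding c_def F_def G_def
    by (intro nn_integral_cong) (auto simp: indicator_def ennreal_mult nonneg)
  finally show ?thesis
    using \<open>c t = 1\<close> by simp
qed

section \<open>Stieltjes functions on the strip\<close>

text \<open>By symmetry this is the jump of \<open>H\<close> across the cut over
  \<open>2 * pi * \<i>\<close>, times the numerator \<open>exp u\<close> of the edge kernel.\<close>

definition edge_density :: "(complex \<Rightarrow> complex) \<Rightarrow> real \<Rightarrow> real" where
  "edge_density H u = exp u * Im (H (Complex u (-pi))) / pi"

text \<open>The hypotheses of \<open>strip_poisson_formula\<close>, which represents
  \<open>H (ln lambda)\<close>, \<open>lambda > 0\<close>, as a Stieltjes transform.\<close>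

locale stieltjes_strip =
  fixes H :: "complex \<Rightarrow> complex" and B :: "real \<Rightarrow> real"
  assumes holo: "H holomorphic_on strip"
    and sym: "\<And>w. w \<in> strip \<Longrightarrow> H (cnj w) = cnj (H w)"
    and pos: "\<And>u. Im (H (Complex u (-pi))) \<ge> 0"
    and bound: "\<And>w. w \<in> strip \<Longrightarrow> cmod (H w) \<le> B (Re w)"
    and top: "(B \<longlongrightarrow> 0) at_top"
    and bot: "((\<lambda>u. exp u * B u) \<longlongrightarrow> 0) at_bot"
begin

lemma has_bochner_integral_edge_density:
  assumes "x > 0"
  shows "has_bochner_integral lborel (\<lambda>u. edge_density H u / (exp u + x)) (Re (H (ln x)))"
  using strip_poisson_formula[OF holo sym pos bound top bot, of "ln x"] assms
  by (simp add: edge_density_def mult_ac)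

lemma edge_density_nonneg: "edge_density H u \<ge> 0"
  by (simp add: edge_density_def pos)

sublocale bernstein_density "edge_density H"
proof
  have "continuous_on UNIV (\<lambda>u. H (Complex u (-pi)))"
    by (rule continuous_on_compose2[OF holomorphic_on_imp_continuous_on[OF holo]])
       (auto simp: Complex_eq intro!: continuous_intros)
  then have "continuous_on UNIV (edge_density H)"
    unfolding edge_density_def by (intro continuous_intros) auto
  then show "edge_density H \<in> borel_measurable borel"
    by (rule borel_measurable_continuous_onI)
  show "integrable lborel (\<lambda>u. edge_density H u / (exp u + 1))"
    using has_bochner_integral_edge_density[of 1] by (simp add: has_bochner_integral_iff)
qed (rule edge_density_nonneg)

lemma laplace_edge: "x > 0 \<Longrightarrow> laplace (bernstein_fun (edge_density H)) x = Re (H (ln x))"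
  using has_bochner_integral_edge_density[of x] laplace_bernstein_fun[of x]
  by (simp add: has_bochner_integral_iff)

lemma nn_laplace_edge:
  assumes "x > 0"
  shows "(\<integral>\<^sup>+t. ennreal (exp (- x * t)) * (bernstein_fun (edge_density H) t * indicator {0..} t) \<partial>lborel) =
    ennreal (Re (H (ln x)))"
  unfolding nn_laplace_bernstein_fun[OF assms]
  by (rule nn_integral_eq_integral[THEN trans])
     (use has_bochner_integral_edge_density[OF assms] assms
       in \<open>auto simp: has_bochner_integral_iff intro!: divide_nonneg_pos edge_density_nonneg add_pos_pos\<close>)

end

text \<open>At \<open>x = ln lambda\<close> the product is \<open>1 / lambda\<close>, the Laplace
  transform of the constant 1. Both functions decrease, as \<open>convolution_eq_1\<close>
  requires.\<close>

lemma PC_edge: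
  assumes "stieltjes_strip H B" "stieltjes_strip H' B'"
    and prod: "\<And>x::real. H x * H' x = of_real (exp (- x))"
    and real: "\<And>x::real. Im (H x) = 0" "\<And>x::real. Im (H' x) = 0"
    and nn: "\<And>x::real. Re (H x) \<ge> 0" "\<And>x::real. Re (H' x) \<ge> 0"
  shows "PC (bernstein_fun (edge_density H)) (bernstein_fun (edge_density H'))"
proof -
  interpret H: stieltjes_strip H B by fact
  interpret H': stieltjes_strip H' B' by fact
  have "Re (H (ln x)) * Re (H' (ln x)) = 1 / x" if "x > 0" for x :: real
  proof -
    have "Re (H (ln x) * H' (ln x)) = 1 / x"
      unfolding prod using that by (simp add: exp_minus divide_inverse power2_eq_square)
    then show ?thesis
      using real by simp
  qed
  then have prod: "(\<integral>\<^sup>+t. ennreal (exp (- x * t)) * (bernstein_fun (edge_density H) t * indicator {0..} t) \<partial>lborel) *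
      (\<integral>\<^sup>+t. ennreal (exp (- x * t)) * (bernstein_fun (edge_density H') t * indicator {0..} t) \<partial>lborel) =
      ennreal (1 / x)" if "x > 0" for x
    unfolding H.nn_laplace_edge[OF that] H'.nn_laplace_edge[OF that] using that nn
    by (simp flip: ennreal_mult)
  show ?thesis
    unfolding PC_def
    using H.loc_integrable_bernstein_fun H'.loc_integrable_bernstein_fun
      H.bernstein_fun_nonneg H.bernstein_fun_antimono
      convolution_eq_1[OF H.bernstein_fun_measurable H'.bernstein_fun_measurable H.bernstein_fun_nonneg
        H'.bernstein_fun_nonneg H.bernstein_fun_antimono H'.bernstein_fun_antimono prod]
    by blast
qed

section \<open>The two Stieltjes functions and the conclusion\<close>

text \<open>On the lower edge the iterate has imaginary part in [-pi, 0], so its negative has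
  nonnegative sine. The bound \<open>B\<close> is \<open>Re_funpow_log_quot_ge\<close>
  exponentiated.\<close>

lemma stieltjes_strip_exp_minus:
  assumes "n \<ge> 1"
  shows "stieltjes_strip (\<lambda>w. exp (- (log_quot ^^ n) w)) (\<lambda>u. exp (2 * ln 2 - u / 2 ^ n))"
proof
  show "(\<lambda>w. exp (- (log_quot ^^ n) w)) holomorphic_on strip"
    by (intro holomorphic_intros funpow_log_quot_holomorphic)
  show "exp (- (log_quot ^^ n) (cnj w)) = cnj (exp (- (log_quot ^^ n) w))" if "w \<in> strip" for w
    using funpow_log_quot_cnj[OF that] by (simp add: exp_cnj)
  show "Im (exp (- (log_quot ^^ n) (Complex u (- pi)))) \<ge> 0" for u
  proof -
    have "\<bar>Im ((log_quot ^^ n) (Complex u (- pi)))\<bar> \<le> pi" "Im ((log_quot ^^ n) (Complex u (- pi))) \<le> 0"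
      using funpow_log_quot_strip[of "Complex u (-pi)" n]
        Im_funpow_log_quot_nonpos[of "Complex u (-pi)" n] by auto
    then have "sin (- Im ((log_quot ^^ n) (Complex u (- pi)))) \<ge> 0"
      by (intro sin_ge_zero) auto
    then show ?thesis
      by (simp add: Im_exp mult_nonneg_nonpos)
  qed
  show "cmod (exp (- (log_quot ^^ n) w)) \<le> exp (2 * ln 2 - Re w / 2 ^ n)" if "w \<in> strip" for w
    using Re_funpow_log_quot_ge[OF that, of n] by simp
  \<comment> \<open>Here \<open>n >= 1\<close> enters: only \<open>c < 1\<close> lets
    \<open>exp u\<close> beat \<open>exp (- c * u)\<close> at minus infinity.\<close>
  define c :: real where "c = 1 / 2 ^ n"
  have c: "0 < c" "c < 1"
    using assms by (simp_all add: c_def)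
  have "((\<lambda>u. exp u * exp (2 * ln 2 - c * u)) \<longlongrightarrow> 0) at_bot"
    using c by real_asymp
  then show "((\<lambda>u::real. exp u * exp (2 * ln 2 - u / 2 ^ n)) \<longlongrightarrow> 0) at_bot"
    by (simp add: c_def)
  have "((\<lambda>u. exp (2 * ln 2 - c * u)) \<longlongrightarrow> 0) at_top"
    using c by real_asymp
  then show "((\<lambda>u::real. exp (2 * ln 2 - u / 2 ^ n)) \<longlongrightarrow> 0) at_top"
    by (simp add: c_def)
qed

text \<open>Subtracting \<open>w\<close> on the lower edge shifts the imaginary part from [-pi, 0]
  to [0, pi]. At infinity \<open>B u\<close> is equivalent to \<open>1 / u ^ n\<close>, which tends
  to 0 as \<open>n >= 1\<close>.\<close>

lemma stieltjes_strip_exp_diff: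
  assumes "n \<ge> 1"
  shows "stieltjes_strip (\<lambda>w. exp ((log_quot ^^ n) w - w)) (\<lambda>u. exp ((log_quot ^^ n) u - u))"
proof
  show "(\<lambda>w. exp ((log_quot ^^ n) w - w)) holomorphic_on strip"
    by (intro holomorphic_intros funpow_log_quot_holomorphic)
  show "exp ((log_quot ^^ n) (cnj w) - cnj w) = cnj (exp ((log_quot ^^ n) w - w))" if "w \<in> strip" for w
    using funpow_log_quot_cnj[OF that] by (simp add: exp_cnj)
  show "Im (exp ((log_quot ^^ n) (Complex u (- pi)) - Complex u (- pi))) \<ge> 0" for u
  proof -
    have "\<bar>Im ((log_quot ^^ n) (Complex u (- pi)))\<bar> \<le> pi" "Im ((log_quot ^^ n) (Complex u (- pi))) \<le> 0"
      using funpow_log_quot_strip[of "Complex u (-pi)" n]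
        Im_funpow_log_quot_nonpos[of "Complex u (-pi)" n] by auto
    then have "sin (Im ((log_quot ^^ n) (Complex u (- pi))) + pi) \<ge> 0"
      by (intro sin_ge_zero) auto
    then show ?thesis
      by (simp add: Im_exp mult_nonneg_nonpos)
  qed
  show "cmod (exp ((log_quot ^^ n) w - w)) \<le> exp ((log_quot ^^ n) (Re w) - Re w)" if "w \<in> strip" for w
    using Re_funpow_log_quot_le[OF that, of n] by simp
  have "(\<lambda>u::real. exp (- u) * inverse (exp (- (log_quot ^^ n) u))) \<sim>[at_top]
      (\<lambda>u. exp (- u) * inverse (exp (- u) * u ^ n))"
    by (intro asymp_equiv_intros exp_funpow_log_quot_at_top)
  also have "(\<lambda>u::real. exp (- u) * inverse (exp (- u) * u ^ n)) = (\<lambda>u. inverse (u ^ n))"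
    by (simp add: fun_eq_iff exp_minus)
  also have "(\<lambda>u::real. exp (- u) * inverse (exp (- (log_quot ^^ n) u))) = (\<lambda>u. exp ((log_quot ^^ n) u - u))"
    by (simp add: fun_eq_iff exp_minus exp_diff divide_inverse)
  finally have "(\<lambda>u::real. exp ((log_quot ^^ n) u - u)) \<sim>[at_top] (\<lambda>u. inverse (u ^ n))" .
  moreover have "((\<lambda>u::real. inverse (u ^ n)) \<longlongrightarrow> 0) at_top"
    using assms by (intro tendsto_inverse_0_at_top filterlim_pow_at_top filterlim_ident) auto
  ultimately show "((\<lambda>u::real. exp ((log_quot ^^ n) u - u)) \<longlongrightarrow> 0) at_top"
    using asymp_equiv_tendsto_transfer asymp_equiv_symI by blast
  \<comment> \<open>At minus infinity \<open>exp u * B u\<close> is the reciprocal of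
    \<open>exp (- (log_quot ^^ n) u)\<close>, which with \<open>t = exp (- u)\<close> grows like the
    \<open>n\<close>-fold logarithm of \<open>t\<close>.\<close>
  have "filterlim (\<lambda>t::real. exp (- (log_quot ^^ n) (- ln t))) at_top at_top"
    using asymp_equiv_at_top_transfer[OF asymp_equiv_symI[OF exp_funpow_log_quot_at_bot]] filterlim_funpow_ln by blast
  moreover have "filterlim (\<lambda>u::real. exp (- u)) at_top at_bot"
    by real_asymp
  ultimately have "filterlim (\<lambda>u::real. exp (- (log_quot ^^ n) (- ln (exp (- u))))) at_top at_bot"
    by (rule filterlim_compose)
  then have "((\<lambda>u::real. inverse (exp (- (log_quot ^^ n) u))) \<longlongrightarrow> 0) at_bot"
    by (intro tendsto_inverse_0_at_top) simp
  then show "((\<lambda>u::real. exp u * exp ((log_quot ^^ n) u - u)) \<longlongrightarrow> 0) at_bot"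
    by (simp add: exp_minus exp_diff)
qed

theorem corollary3p13:
  fixes n :: nat
  assumes "n \<ge> 1"
  shows "\<exists>\<phi> \<psi> :: real \<Rightarrow> real.
           PC \<phi> \<psi> \<and> completely_monotone \<phi> \<and>
           (\<lambda>t. laplace \<psi> (inverse t)) \<sim>[at_top] (ln ^^ n) \<and>
           (\<lambda>t. laplace \<psi> (inverse t)) \<sim>[at_right 0] (\<lambda>t. t * (ln (inverse t)) ^ n)"
proof (intro exI conjI)
  define H H' where "H w = exp ((log_quot ^^ n) w - w)" and "H' w = exp (- (log_quot ^^ n) w)" for w :: complex
  have H: "stieltjes_strip H (\<lambda>u. exp ((log_quot ^^ n) u - u))"
    and H': "stieltjes_strip H' (\<lambda>u. exp (2 * ln 2 - u / 2 ^ n))"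
    unfolding H_def H'_def using stieltjes_strip_exp_diff[OF assms] stieltjes_strip_exp_minus[OF assms] by auto
  interpret H: stieltjes_strip H "\<lambda>u. exp ((log_quot ^^ n) u - u)" by fact
  interpret H': stieltjes_strip H' "\<lambda>u. exp (2 * ln 2 - u / 2 ^ n)" by fact
  have real: "H (of_real x) = of_real (exp ((log_quot ^^ n) x - x))"
     "H' (of_real x) = of_real (exp (- (log_quot ^^ n) x))" for x
    by (simp_all add: H_def H'_def funpow_log_quot_of_real exp_of_real flip: of_real_diff of_real_minus)
  let ?\<phi> = "bernstein_fun (edge_density H)" and ?\<psi> = "bernstein_fun (edge_density H')"
  show "PC ?\<phi> ?\<psi>"
    by (rule PC_edge[OF H H']) (simp_all add: real flip: of_real_mult exp_add)
  show "completely_monotone ?\<phi>"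
    by (rule H.completely_monotone_bernstein_fun)
  \<comment> \<open>The real argument \<open>ln (inverse t)\<close> tends to minus infinity as
    \<open>t\<close> grows and to infinity as \<open>t\<close> tends to 0 from the right, so each
    regime is covered by one of the two asymptotic lemmas.\<close>
  have laplace: "laplace ?\<psi> (inverse t) = exp (- (log_quot ^^ n) (ln (inverse t)))" if "t > 0" for t
    using that by (simp add: H'.laplace_edge real)
  have ev: "\<forall>\<^sub>F t in at_top. exp (- (log_quot ^^ n) (- ln t)) = laplace ?\<psi> (inverse t)"
    using eventually_gt_at_top[of 0] by eventually_elim (simp add: laplace ln_inverse)
  show "(\<lambda>t. laplace ?\<psi> (inverse t)) \<sim>[at_top] (ln ^^ n)"
    by (rule asymp_equiv_transfer[OF exp_funpow_log_quot_at_bot ev]) simp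
  have "filterlim (\<lambda>t::real. ln (inverse t)) at_top (at_right 0)"
    by real_asymp
  from asymp_equiv_compose'[OF exp_funpow_log_quot_at_top[of n] this]
  have "(\<lambda>t. exp (- (log_quot ^^ n) (ln (inverse t)))) \<sim>[at_right 0]
      (\<lambda>t::real. exp (- ln (inverse t)) * ln (inverse t) ^ n)" .
  moreover have "\<forall>\<^sub>F t in at_right 0. exp (- (log_quot ^^ n) (ln (inverse t))) = laplace ?\<psi> (inverse t)"
    "\<forall>\<^sub>F t::real in at_right 0. exp (- ln (inverse t)) * ln (inverse t) ^ n = t * (ln (inverse t)) ^ n"
    using eventually_at_right_less[of 0] by (eventually_elim, simp add: laplace exp_minus)+
  ultimately show "(\<lambda>t. laplace ?\<psi> (inverse t)) \<sim>[at_right 0] (\<lambda>t. t * (ln (inverse t)) ^ n)"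
    by (rule asymp_equiv_transfer)
qed

end
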